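(* Let $m\ge1$ be an integer and let $\alpha\ge 1$ be real. For $n\ge 2$ let $$d_n=\inf_{u_1,\dots,u_n\in(0,\infty)}\ \frac{2}{n(n-1)}\sum_{1\le i<j\le n}k_n(u_i,u_j),$$ $$k_n(x,y)=-\log\left(\frac{c}{n}\,|x-y|\,v_n(x)^{\frac1{2(n-1)}}\,v_n(y)^{\frac1{2(n-1)}}\right),$$ where $v_n=v_{m,n}^{(\alpha+1)}$ is the weight on $(0,\infty)$ built from the exceptional zeros of the exceptional Laguerre polynomial of the first kind $L_{m,m+n}^{I,(\alpha)}$ and $c>0$ is a constant independent of $n$. Then, as $n\to\infty$, $$d_n=d_{n-1}+O\left(\frac{\log^2 n}{n^2}\right).$$
   Context: $L_k^{(a)}$ denotes the classical Laguerre polynomial of degree $k$ with parameter $a$ (leading coefficient $(-1)^k/k!$), satisfying $xy''+(a+1-x)y'+ky=0$. Exceptional Laguerre polynomials of the first kind of codimension $m\ge1$: for $\alpha>0$ and $n\ge 0$, with $S(x)=L_m^{(\alpha-1)}(-x)$, $L_{m,m+n}^{I,(\alpha)}$ is the polynomial of degree $m+n$ with leading coefficient $\frac{(-1)^n}{m!\,n!}$ which satisfies $$y''(x)+\left(\frac{\alpha+1-x}{x}-\frac{2S'(x)}{S(x)}\right)y'(x)+\left(\frac{m+n}{x}-\frac{\alpha}{x}\frac{2S'(x)}{S(x)}\right)y(x)=0$$ (away from $0$ and the zeros of $S$); these conditions determine it uniquely. It is known that for $\alpha>0$ it has exactly $m$ simple zeros $z_{m,n,1}>\dots>z_{m,n,m}$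 in $(-\infty,0)$ (exceptional zeros) and exactly $n$ simple zeros in $(0,\infty)$ (regular zeros). Put $P_{m,n}(x)=\frac1{m!}\prod_{i=1}^m(x-z_{m,n,i})$ and $$v_{m,n}^{(\alpha+1)}(x)=\frac{x^{\alpha+1}e^{-x}P_{m,n}(x)^2}{S(x)^2},\qquad x\in(0,\infty).$$ The constant $c$ in $k_n$ is fixed, independent of $n$, chosen so that the kernels $k_n$ are positive (its value only adds a constant to all $d_n$). The implied constant in $O(\cdot)$ may depend on $m$ and $\alpha$. *)

theory Defs
  imports
    "HOL-Analysis.Analysis"
    "HOL-Computational_Algebra.Polynomial"
    "HOL-Library.Landau_Symbols"
begin

definition laguerre :: "nat \<Rightarrow> real \<Rightarrow> real poly" where
  "laguerre k a = (\<Sum>i\<le>k. monom ((-1) ^ i * ((real k + a) gchoose (k - i)) / fact i) i)"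

lemma coeff_laguerre:
  "coeff (laguerre k a) i =
     (if i \<le> k then (-1) ^ i * ((real k + a) gchoose (k - i)) / fact i else 0)"
  by (simp add: laguerre_def coeff_sum)

lemma degree_laguerre [simp]: "degree (laguerre k a) = k"
proof (rule antisym)
  show "degree (laguerre k a) \<le> k"
    by (rule degree_le) (simp add: coeff_laguerre)
  show "k \<le> degree (laguerre k a)"
    by (rule le_degree) (simp add: coeff_laguerre)
qed

lemma lead_coeff_laguerre: "lead_coeff (laguerre k a) = (-1) ^ k / fact k"
  by (simp add: coeff_laguerre)

lemma coeff_laguerre_rec:
  "(real i + 1) * (real i + a + 1) * coeff (laguerre k a) (Suc i)
     = (real i - real k) * coeff (laguerre k a) i"
proof (cases "i < k")
  case True
  define j where "j = k - Suc i"
  have k: "k = i + Suc j" using True by (simp add: j_def)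
  have b: "(real i + a + 1) * ((real k + a) gchoose j) = (real j + 1) * ((real k + a) gchoose Suc j)"
    using gbinomial_absorb_comp[of "real k + a" j] gbinomial_absorption[of j "real k + a"]
    by (simp add: k algebra_simps)
  have "(real i + 1) * (real i + a + 1) * coeff (laguerre k a) (Suc i)
      = - ((-1) ^ i) * ((real i + a + 1) * ((real k + a) gchoose j)) / fact i"
    by (simp add: coeff_laguerre k divide_simps del: of_nat_Suc)
  also have "\<dots> = (real i - real k) * coeff (laguerre k a) i"
    unfolding b by (simp add: coeff_laguerre k algebra_simps)
  finally show ?thesis .
qed (auto simp: coeff_laguerre)

lemma laguerre_ode:
  "[:0, 1:] * pderiv (pderiv (laguerre k a)) + [:a + 1, -1:] * pderiv (laguerre k a)
     + smult (real k) (laguerre k a) = 0"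
proof (rule poly_eqI)
  fix i
  show "coeff ([:0, 1:] * pderiv (pderiv (laguerre k a)) + [:a + 1, -1:] * pderiv (laguerre k a)
     + smult (real k) (laguerre k a)) i = coeff 0 i"
    using coeff_laguerre_rec[of i a k]
    by (cases i) (simp_all add: coeff_pderiv algebra_simps)
qed

definition xlaguerre_S :: "nat \<Rightarrow> real \<Rightarrow> real poly" where
  "xlaguerre_S m \<alpha> = pcompose (laguerre m (\<alpha> - 1)) [:0, -1:]"

definition is_xlaguerre :: "nat \<Rightarrow> real \<Rightarrow> nat \<Rightarrow> real poly \<Rightarrow> bool" where
  "is_xlaguerre m \<alpha> n y \<longleftrightarrow>
     degree y = m + n \<and>
     lead_coeff y = (-1) ^ n / (fact m * fact n) \<and>
     (\<forall>x. x \<noteq> 0 \<and> poly (xlaguerre_S m \<alpha>) x \<noteq> 0 \<longrightarrow>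
        poly (pderiv (pderiv y)) x
        + ((\<alpha> + 1 - x) / x
             - 2 * poly (pderiv (xlaguerre_S m \<alpha>)) x / poly (xlaguerre_S m \<alpha>) x)
          * poly (pderiv y) x
        + ((real m + real n) / x
             - \<alpha> / x * (2 * poly (pderiv (xlaguerre_S m \<alpha>)) x / poly (xlaguerre_S m \<alpha>) x))
          * poly y x = 0)"

(* Uniqueness: a nonzero polynomial solution of degree k forces k = m + n, because the
   coefficient of x^(m+k) in x S times the equation is (m + n - k) times the leading
   coefficients of S and y.
   Existence: L_m^(alpha)(-x) L_n^(alpha-1)(x) + L_m^(alpha-1)(-x) L_(n-1)^(alpha)(x)
   is a solution, the second summand being absent for n = 0. *)
definition xlaguerre :: "nat \<Rightarrow> real \<Rightarrow> nat \<Rightarrow> real poly" where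
  "xlaguerre m \<alpha> n = (THE y. is_xlaguerre m \<alpha> n y)"

definition exceptional_zeros :: "nat \<Rightarrow> real \<Rightarrow> nat \<Rightarrow> real set" where
  "exceptional_zeros m \<alpha> n = {z. z < 0 \<and> poly (xlaguerre m \<alpha> n) z = 0}"

definition xlaguerre_P :: "nat \<Rightarrow> real \<Rightarrow> nat \<Rightarrow> real \<Rightarrow> real" where
  "xlaguerre_P m \<alpha> n x = 1 / fact m * (\<Prod>z\<in>exceptional_zeros m \<alpha> n. x - z)"

(* The weight v with upper index alpha + 1, built from the polynomials with parameter alpha. *)
definition xweight :: "nat \<Rightarrow> real \<Rightarrow> nat \<Rightarrow> real \<Rightarrow> real" where
  "xweight m \<alpha> n x =
     x powr (\<alpha> + 1) * exp (- x) * (xlaguerre_P m \<alpha> n x)\<^sup>2 / (poly (xlaguerre_S m \<alpha>) x)\<^sup>2"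

(* Extended logarithm: the kernel below must be +infinity on the diagonal,
   whereas the library has ln 0 = 0. *)
definition elog :: "real \<Rightarrow> ereal" where
  "elog t = (if t \<le> 0 then - \<infinity> else ereal (ln t))"

definition kernel :: "real \<Rightarrow> nat \<Rightarrow> real \<Rightarrow> nat \<Rightarrow> real \<Rightarrow> real \<Rightarrow> ereal" where
  "kernel c m \<alpha> n x y =
     - elog (c / real n * \<bar>x - y\<bar>
             * xweight m \<alpha> n x powr (1 / (2 * (real n - 1)))
             * xweight m \<alpha> n y powr (1 / (2 * (real n - 1))))"

(* Only the values for n >= 2 are meaningful. *)
definition min_energy :: "real \<Rightarrow> nat \<Rightarrow> real \<Rightarrow> nat \<Rightarrow> ereal" where
  "min_energy c m \<alpha> n =
     (INF u \<in> {u :: nat \<Rightarrow> real. \<forall>i\<in>{1..n}. 0 < u i}.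
        ereal (2 / (real n * (real n - 1)))
          * (\<Sum>(i, j) \<in> {(i, j). 1 \<le> i \<and> i < j \<and> j \<le> n}. kernel c m \<alpha> n (u i) (u j)))"

end

theory Submission
  imports Defs "HOL-Real_Asymp.Real_Asymp"
begin

text \<open>The infimum \<open>d\<^sub>n\<close> equals \<open>ln n - ln c - E\<^sub>n / (n (n - 1))\<close>, where \<open>E\<^sub>n\<close> is the maximal logarithm of
  a weighted squared Vandermonde product. For the classical weight \<open>x powr (\<alpha> + 1) * exp (- x)\<close> the
  maximum is attained at the zeros of a Laguerre polynomial and Schur's discriminant formula gives
  \<open>E\<^sub>n - E\<^sub>n\<^sub>-\<^sub>1\<close> exactly. The exceptional weight changes \<open>E\<^sub>n\<close> only by \<open>O(1)\<close>: the exceptional zeros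
  are within \<open>O(1 / sqrt n)\<close> of the zeros of \<open>S\<close>, so \<open>ln (P / S)\<close> is of size
  \<open>1 / (sqrt n * (\<beta> + x))\<close> for a constant \<open>\<beta> > 0\<close>, while the equilibrium equations of the maximizing
  points \<open>u\<^sub>i\<close> force \<open>\<Sum> 1 / (\<beta> + u\<^sub>i) = O(sqrt n)\<close>.\<close>

text \<open>The obstacle is the size of the perturbation. At a bounded point the exceptional factor
  moves the logarithm of the weight by order 1 / sqrt n; added over n points without further
  information this is sqrt n, which would put an error of order n powr (-3/2) into d_n. The decay in
  x rescues the estimate, provided few points lie near 0. Both rates of order sqrt n have one
  source: testing the equilibrium equations with 1 / (b + x). The divided difference of this
  function factors, so the double sum over pairs collapses to a square, and the equations become a
  quadratic inequality for \<Sum> 1 / (b + u_i). Read as an upper bound, it controls the maximizing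
  points of every weight whose logarithmic derivative is boundedly close to the classical one; read
  as a lower bound for the Laguerre zeros of parameter \<alpha> - 1, it forces exceptional zeros
  towards the zeros of \<open>S\<close>. No asymptotic expansion of the polynomials enters. A
  bounded error in E_n is harmless because E_n is divided by n (n - 1).\<close>

definition wt :: "real \<Rightarrow> real set \<Rightarrow> real set \<Rightarrow> real \<Rightarrow> real" where
  "wt a Z Y x = x powr (a + 1) * exp (- x) * ((\<Prod>z\<in>Z. x - z) / (\<Prod>y\<in>Y. x - y))\<^sup>2"

definition dlog_wt :: "real \<Rightarrow> real set \<Rightarrow> real set \<Rightarrow> real \<Rightarrow> real" where
  "dlog_wt a Z Y x = (a + 1) / x - 1 + 2 * ((\<Sum>z\<in>Z. 1 / (x - z)) - (\<Sum>y\<in>Y. 1 / (x - y)))"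

text \<open>Ordered pairs are used, so each distance enters twice: at the zeros of a monic
  polynomial this is the absolute value of the discriminant. With this normalization the kernel
  exponent 1 / (2 (n - 1)) leaves exactly one factor \<open>v (u i)\<close> per point in
  \<open>wvandermonde\<close>.\<close>

definition vandermonde :: "nat set \<Rightarrow> (nat \<Rightarrow> real) \<Rightarrow> real" where
  "vandermonde I u = (\<Prod>i\<in>I. \<Prod>j\<in>I - {i}. \<bar>u i - u j\<bar>)"

definition wvandermonde :: "(real \<Rightarrow> real) \<Rightarrow> nat set \<Rightarrow> (nat \<Rightarrow> real) \<Rightarrow> real" where
  "wvandermonde v I u = vandermonde I u * (\<Prod>i\<in>I. v (u i))"

text \<open>Distinctness is recorded so that the maximal product is positive and its logarithm is
  meaningful.\<close>

definition is_fekete :: "(real \<Rightarrow> real) \<Rightarrow> nat set \<Rightarrow> (nat \<Rightarrow> real) \<Rightarrow> bool" where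
  "is_fekete v I u \<longleftrightarrow> (\<forall>i\<in>I. 0 < u i) \<and> inj_on u I \<and>
     (\<forall>w. (\<forall>i\<in>I. 0 < w i) \<longrightarrow> wvandermonde v I w \<le> wvandermonde v I u)"

subsection \<open>Sums over pairs and equilibrium equations\<close>

lemma sum_offdiag_swap:
  fixes g :: "'i \<Rightarrow> 'i \<Rightarrow> 'b::comm_monoid_add"
  assumes "finite I"
  shows "(\<Sum>i\<in>I. \<Sum>j\<in>I - {i}. g i j) = (\<Sum>i\<in>I. \<Sum>j\<in>I - {i}. g j i)"
proof -
  have eq: "I - {i} = {j. j \<in> I \<and> i \<noteq> j}" "I - {i} = {j. j \<in> I \<and> j \<noteq> i}" for i by auto
  have "(\<Sum>i\<in>I. \<Sum>j | j \<in> I \<and> i \<noteq> j. g i j) = (\<Sum>j\<in>I. \<Sum>i | i \<in> I \<and> i \<noteq> j. g i j)"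
    by (rule sum.swap_restrict) (use assms in auto)
  then show ?thesis by (simp only: eq(1)[symmetric] eq(2)[symmetric])
qed

lemma prod_offdiag_swap:
  fixes g :: "'i \<Rightarrow> 'b::comm_monoid_mult"
  assumes "finite I"
  shows "(\<Prod>i\<in>I. \<Prod>j\<in>I - {i}. g j) = (\<Prod>i\<in>I. \<Prod>j\<in>I - {i}. g i)"
proof -
  have eq: "I - {i} = {j. j \<in> I \<and> i \<noteq> j}" "I - {i} = {j. j \<in> I \<and> j \<noteq> i}" for i by auto
  have "(\<Prod>i\<in>I. \<Prod>j | j \<in> I \<and> i \<noteq> j. g j) = (\<Prod>j\<in>I. \<Prod>i | i \<in> I \<and> i \<noteq> j. g j)"
    by (rule prod.swap_restrict) (use assms in auto)
  then show ?thesis by (simp only: eq(1)[symmetric] eq(2)[symmetric])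
qed

text \<open>Multiply the equation at \<open>u k\<close> by \<open>\<phi> (u k)\<close>, sum over
  \<open>k\<close>, and average with the sum in which the two indices are exchanged: the
  antisymmetric kernel turns into a divided difference of \<open>\<phi>\<close>. The choices 1, x
  and 1 / (b + x) make the double sum explicit.\<close>

lemma stationary_weighted_sum:
  fixes u h \<phi> :: "_ \<Rightarrow> real"
  assumes "finite I" and stat: "\<And>k. k \<in> I \<Longrightarrow> (\<Sum>j\<in>I - {k}. 2 / (u k - u j)) + h (u k) = 0"
  shows "(\<Sum>k\<in>I. \<phi> (u k) * h (u k)) =
         - (\<Sum>k\<in>I. \<Sum>j\<in>I - {k}. (\<phi> (u k) - \<phi> (u j)) / (u k - u j))"
proof -
  have "(\<Sum>k\<in>I. \<phi> (u k) * h (u k)) = (\<Sum>k\<in>I. - (\<phi> (u k) * (\<Sum>j\<in>I - {k}. 2 / (u k - u j))))"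
  proof (rule sum.cong[OF refl])
    fix k assume "k \<in> I"
    then have "h (u k) = - (\<Sum>j\<in>I - {k}. 2 / (u k - u j))" using stat by fastforce
    then show "\<phi> (u k) * h (u k) = - (\<phi> (u k) * (\<Sum>j\<in>I - {k}. 2 / (u k - u j)))" by simp
  qed
  also have "\<dots> = - (2 * (\<Sum>k\<in>I. \<Sum>j\<in>I - {k}. \<phi> (u k) / (u k - u j)))"
    by (simp add: sum_distrib_left sum_negf mult_ac)
  also have "2 * (\<Sum>k\<in>I. \<Sum>j\<in>I - {k}. \<phi> (u k) / (u k - u j)) =
     (\<Sum>k\<in>I. \<Sum>j\<in>I - {k}. \<phi> (u k) / (u k - u j)) + (\<Sum>k\<in>I. \<Sum>j\<in>I - {k}. \<phi> (u j) / (u j - u k))"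
    using sum_offdiag_swap[OF assms(1), of "\<lambda>k j. \<phi> (u k) / (u k - u j)"] by simp
  also have "\<dots> = (\<Sum>k\<in>I. \<Sum>j\<in>I - {k}. \<phi> (u k) / (u k - u j) + \<phi> (u j) / (u j - u k))"
    by (simp add: sum.distrib)
  also have "\<dots> = (\<Sum>k\<in>I. \<Sum>j\<in>I - {k}. (\<phi> (u k) - \<phi> (u j)) / (u k - u j))"
  proof (intro sum.cong refl)
    fix k j
    have "\<phi> (u j) / (u j - u k) = - (\<phi> (u j) / (u k - u j))"
      by (metis minus_diff_eq minus_divide_right)
    then show "\<phi> (u k) / (u k - u j) + \<phi> (u j) / (u j - u k) = (\<phi> (u k) - \<phi> (u j)) / (u k - u j)"
      by (simp add: diff_divide_distrib)
  qed
  finally show ?thesis .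
qed

locale stationary =
  fixes I :: "nat set" and u :: "nat \<Rightarrow> real" and h :: "real \<Rightarrow> real"
  assumes fin: "finite I" and pos: "i \<in> I \<Longrightarrow> 0 < u i" and inj: "inj_on u I"
    and stat: "k \<in> I \<Longrightarrow> (\<Sum>j\<in>I - {k}. 2 / (u k - u j)) + h (u k) = 0"
begin

lemma sum_h: "(\<Sum>k\<in>I. h (u k)) = 0"
  using stationary_weighted_sum[OF fin stat, of "\<lambda>_. 1"] by simp

lemma distinct: "k \<in> I \<Longrightarrow> j \<in> I - {k} \<Longrightarrow> u k \<noteq> u j"
  using inj by (auto simp: inj_on_def)

text \<open>The divided difference of the identity is 1 on each ordered pair. For the classical
  weight this determines the sum of the Laguerre zeros.\<close>

lemma sum_mult_h: "(\<Sum>k\<in>I. u k * h (u k)) = - (real (card I) * (real (card I) - 1))"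
proof -
  have "(\<Sum>k\<in>I. \<Sum>j\<in>I - {k}. (u k - u j) / (u k - u j)) = (\<Sum>k\<in>I. \<Sum>j\<in>I - {k}. 1)"
    by (intro sum.cong refl) (use distinct in fastforce)
  also have "\<dots> = (\<Sum>k\<in>I. real (card I) - 1)"
    using fin by (intro sum.cong refl) (simp add: card_Diff_singleton of_nat_diff card_gt_0_iff Suc_le_eq, metis card_0_eq emptyE of_nat_diff One_nat_def Suc_leI neq0_conv of_nat_1)
  also have "\<dots> = real (card I) * (real (card I) - 1)" by simp
  finally show ?thesis
    using stationary_weighted_sum[OF fin stat, of "\<lambda>x. x"] by simp
qed

text \<open>The divided difference of 1 / (b + x) at two points is minus the product of its two
  values, so the off-diagonal double sum is a full square minus its diagonal.\<close>

lemma sum_shifted_h: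
  assumes "0 \<le> b"
  shows "(\<Sum>k\<in>I. h (u k) / (b + u k)) = (\<Sum>k\<in>I. 1 / (b + u k))\<^sup>2 - (\<Sum>k\<in>I. 1 / (b + u k)\<^sup>2)"
proof -
  let ?g = "\<lambda>k. 1 / (b + u k)"
  have "(\<Sum>k\<in>I. h (u k) / (b + u k)) =
        - (\<Sum>k\<in>I. \<Sum>j\<in>I - {k}. (?g k - ?g j) / (u k - u j))"
    using stationary_weighted_sum[OF fin stat, of "\<lambda>x. 1 / (b + x)"] by simp
  also have "\<dots> = (\<Sum>k\<in>I. \<Sum>j\<in>I - {k}. ?g k * ?g j)"
    unfolding sum_negf[symmetric]
  proof (intro sum.cong refl)
    fix k j assume k: "k \<in> I" and j: "j \<in> I - {k}"
    have "0 < b + u k" "0 < b + u j" "u k - u j \<noteq> 0" using pos[of k] pos[of j] k j assms distinct[OF k j] by auto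
    have inv: "1 / p - 1 / q = - (1 / p * (1 / q)) * (p - q)" if "0 < p" "0 < q" for p q :: real
      using that by (simp add: field_simps)
    have "?g k - ?g j = - (?g k * ?g j) * (u k - u j)"
      using inv[of "b + u k" "b + u j"] \<open>0 < b + u k\<close> \<open>0 < b + u j\<close> by simp
    then show "- ((?g k - ?g j) / (u k - u j)) = ?g k * ?g j" using \<open>u k - u j \<noteq> 0\<close> by simp
  qed
  also have "\<dots> = (\<Sum>k\<in>I. ?g k * ((\<Sum>j\<in>I. ?g j) - ?g k))"
    using fin by (intro sum.cong refl) (simp only: sum_distrib_left[symmetric] sum_diff1 if_True)
  also have "\<dots> = (\<Sum>k\<in>I. 1 / (b + u k))\<^sup>2 - (\<Sum>k\<in>I. 1 / (b + u k)\<^sup>2)"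
    unfolding right_diff_distrib sum_subtractf sum_distrib_right[symmetric] by (simp add: power2_eq_square)
  finally show ?thesis .
qed

lemma sum_inverse_shifted_sq_le:
  assumes "0 < b" shows "(\<Sum>k\<in>I. 1 / (b + u k)\<^sup>2) \<le> (\<Sum>k\<in>I. 1 / (b + u k)) / b"
  unfolding sum_divide_distrib
proof (rule sum_mono)
  fix k assume "k \<in> I"
  then have "0 < u k" by (rule pos)
  then show "1 / (b + u k)\<^sup>2 \<le> 1 / (b + u k) / b"
    using assms by (simp add: power2_eq_square divide_simps)
qed

text \<open>Summing the equilibrium equations bounds \<open>\<Sum> a1 / u k\<close> by a multiple of
  the number of points; inserted into \<open>sum_shifted_h\<close> this gives W^2 <= W / b + O(card
  I) for the sum W on the left. The constants \<open>C0\<close> and \<open>C2\<close> leave room for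
  a bounded perturbation of the classical logarithmic derivative.\<close>

lemma sum_inverse_upper:
  assumes "0 < a1" "0 \<le> C0" "0 \<le> C2" "0 < b"
    and up: "\<And>x. 0 < x \<Longrightarrow> h x \<le> a1 / x + C0"
    and lo: "\<And>x. 0 < x \<Longrightarrow> a1 / x - C2 \<le> h x"
  shows "(\<Sum>k\<in>I. 1 / (b + u k)) \<le> 2 / b + sqrt (2 * (C0 + C2) / b) * sqrt (card I)"
proof -
  define W where "W = (\<Sum>k\<in>I. 1 / (b + u k))"
  have W0: "0 \<le> W" unfolding W_def using pos \<open>0 < b\<close> by (intro sum_nonneg) (auto simp: less_imp_le add_pos_pos)
  have "(\<Sum>k\<in>I. a1 / u k) - C2 * card I = (\<Sum>k\<in>I. a1 / u k - C2)"
    by (simp add: sum_subtractf)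
  also have "\<dots> \<le> (\<Sum>k\<in>I. h (u k))" by (intro sum_mono lo pos)
  finally have inv: "(\<Sum>k\<in>I. a1 / u k) \<le> C2 * card I" by (simp add: sum_h)
  have "(\<Sum>k\<in>I. h (u k) / (b + u k)) \<le> (\<Sum>k\<in>I. (a1 / u k + C0) / b)"
  proof (rule sum_mono)
    fix k assume k: "k \<in> I"
    have p: "0 < u k" by (rule pos[OF k])
    have "h (u k) / (b + u k) \<le> (a1 / u k + C0) / (b + u k)"
      using p \<open>0 < b\<close> by (intro divide_right_mono up) auto
    also have "\<dots> \<le> (a1 / u k + C0) / b"
      using p assms by (intro divide_left_mono) auto
    finally show "h (u k) / (b + u k) \<le> (a1 / u k + C0) / b" .
  qed
  also have "\<dots> = ((\<Sum>k\<in>I. a1 / u k) + C0 * card I) / b"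
    by (simp add: sum_divide_distrib[symmetric] sum.distrib)
  also have "\<dots> \<le> (C2 * card I + C0 * card I) / b"
    using inv \<open>0 < b\<close> by (intro divide_right_mono add_mono) auto
  finally have "W\<^sup>2 - (\<Sum>k\<in>I. 1 / (b + u k)\<^sup>2) \<le> (C0 + C2) / b * card I"
    using sum_shifted_h[of b] \<open>0 < b\<close> unfolding W_def by (simp add: algebra_simps)
  with sum_inverse_shifted_sq_le[OF \<open>0 < b\<close>] have q: "W\<^sup>2 \<le> W / b + (C0 + C2) / b * card I"
    unfolding W_def by linarith
  have s: "sqrt (2 * (C0 + C2) / b) * sqrt (card I) = sqrt (2 * ((C0 + C2) / b * card I))"
    by (simp add: real_sqrt_mult[symmetric])
  \<comment> \<open>Above the threshold 2 / b the linear term W / b takes at most half of W^2 and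
    can be absorbed.\<close>
  show ?thesis
  proof (cases "W \<le> 2 / b")
    case True then show ?thesis unfolding W_def using assms by (smt (verit) divide_nonneg_pos mult_nonneg_nonneg real_sqrt_ge_zero of_nat_0_le_iff)
  next
    case False
    then have "W * (2 / b) \<le> W * W" using W0 by (intro mult_left_mono) auto
    then have "W / b \<le> W\<^sup>2 / 2" by (simp add: power2_eq_square)
    then have "W\<^sup>2 \<le> 2 * ((C0 + C2) / b * card I)" using q by linarith
    then have "W \<le> sqrt (2 * ((C0 + C2) / b * card I))" by (rule real_le_rsqrt)
    then show ?thesis unfolding W_def[symmetric] s using \<open>0 < b\<close> by (smt (verit) divide_nonneg_pos)
  qed
qed

end

subsection \<open>Existence of Fekete points\<close>

lemma vandermonde_pos: "inj_on u I \<Longrightarrow> 0 < vandermonde I u"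
  unfolding vandermonde_def by (intro prod_pos) (auto simp: inj_on_def)

lemma prod_has_log_derivative:
  fixes f :: "'i \<Rightarrow> real \<Rightarrow> real"
  assumes "finite I" and "\<And>i. i \<in> I \<Longrightarrow> (f i has_real_derivative f i x * g i) (at x)"
  shows "((\<lambda>x. \<Prod>i\<in>I. f i x) has_real_derivative (\<Prod>i\<in>I. f i x) * (\<Sum>i\<in>I. g i)) (at x)"
  using assms
proof (induction I rule: finite_induct)
  case (insert k I)
  have "((\<lambda>x. f k x * (\<Prod>i\<in>I. f i x)) has_real_derivative
      f k x * ((\<Prod>i\<in>I. f i x) * (\<Sum>i\<in>I. g i)) + f k x * g k * (\<Prod>i\<in>I. f i x)) (at x)"
    by (rule DERIV_mult'[OF insert.prems insert.IH]) (use insert.prems in auto)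
  then show ?case using insert.hyps by (simp add: algebra_simps)
qed simp

lemma power_div_fact_le_exp:
  fixes x :: real
  assumes "0 \<le> x" shows "x ^ n / fact n \<le> exp x"
proof -
  have "(\<Sum>k\<in>{n}. x ^ k / fact k) \<le> (\<Sum>k. x ^ k / fact k)"
    using summable_exp[of x] assms by (intro sum_le_suminf) (auto simp: divide_inverse mult.commute)
  then show ?thesis by (simp add: exp_def divide_inverse mult.commute)
qed

text \<open>One locale serves both weights: the classical one with \<open>Z\<close> and
  \<open>Y\<close> empty, and the exceptional one with the exceptional zeros over the zeros of
  \<open>S\<close>, where the two constants 1 / m! cancel. The exponent \<open>a + 1\<close> is the
  one whose equilibrium points are the zeros of the Laguerre polynomial with parameter
  \<open>a\<close>.\<close>

locale weight =
  fixes a :: real and Z Y :: "real set"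
  assumes a: "-1 < a" and finZ: "finite Z" and finY: "finite Y"
    and negZ: "z \<in> Z \<Longrightarrow> z < 0" and negY: "y \<in> Y \<Longrightarrow> y < 0"
begin

abbreviation v where "v \<equiv> wt a Z Y"

lemma prod_Z_pos: "0 \<le> x \<Longrightarrow> 0 < (\<Prod>z\<in>Z. x - z)"
  by (intro prod_pos) (use negZ in force)

lemma prod_Y_pos: "0 \<le> x \<Longrightarrow> 0 < (\<Prod>y\<in>Y. x - y)"
  by (intro prod_pos) (use negY in force)

lemma v_pos: "0 < x \<Longrightarrow> 0 < v x"
  using prod_Z_pos[of x] prod_Y_pos[of x] by (simp add: wt_def)

lemma v_nonneg: "0 \<le> v x" by (simp add: wt_def)

lemma v_0: "v 0 = 0" using a by (simp add: wt_def)

lemma continuous_on_v: "continuous_on {0..} v"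
proof -
  have "continuous_on {0..} (\<lambda>x::real. x powr (a + 1))"
    by (intro continuous_on_powr' continuous_intros) (use a in auto)
  moreover have "continuous_on {0..} (\<lambda>x. ((\<Prod>z\<in>Z. x - z) / (\<Prod>y\<in>Y. x - y))\<^sup>2)"
    using prod_Y_pos by (intro continuous_intros) (metis atLeast_iff less_irrefl)
  moreover have "continuous_on {0..} (\<lambda>x::real. exp (- x))" by (intro continuous_intros)
  ultimately show ?thesis unfolding wt_def by (metis (no_types) continuous_on_mult)
qed

lemma v_log_derivative:
  assumes "0 < x" shows "(v has_real_derivative v x * dlog_wt a Z Y x) (at x)"
proof -
  have pd: "((\<lambda>x. \<Prod>z\<in>A. x - z) has_real_derivative (\<Prod>z\<in>A. x - z) * (\<Sum>z\<in>A. 1 / (x - z))) (at x)"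
    if "finite A" "\<And>z. z \<in> A \<Longrightarrow> z < 0" for A
    using that assms by (intro prod_has_log_derivative) (force intro!: derivative_eq_intros)+
  note dZ = pd[OF finZ negZ] and dY = pd[OF finY negY]
  have Y: "(\<Prod>y\<in>Y. x - y) \<noteq> 0" using prod_Y_pos[of x] assms by simp
  show ?thesis unfolding wt_def
    apply (rule derivative_eq_intros dZ dY refl Y assms | simp add: assms)+
    using assms Y
    by (simp add: dlog_wt_def powr_diff powr_add power2_eq_square divide_simps) (simp add: algebra_simps)
qed

text \<open>The exponential beats every power: \<open>M\<close> collects all powers of 1 + x, with
  \<open>K\<close> rounding up the exponent a + 1, and one term of the exponential series at 1 + x
  gives the bound. The spare factor 1 / (1 + x) is what keeps maximizing points bounded.\<close>

lemma v_growth: "\<exists>C>0. \<forall>x\<ge>0. (1 + x) ^ N * v x \<le> C / (1 + x)"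
proof -
  define K where "K = nat \<lceil>a + 1\<rceil>"
  define CZ where "CZ = (\<Prod>z\<in>Z. 1 - z)"
  define DY where "DY = (\<Prod>y\<in>Y. 0 - y)"
  define M where "M = N + 1 + K + 2 * card Z"
  define C where "C = (CZ / DY)\<^sup>2 * (fact M * exp 1)"
  have DY: "0 < DY" unfolding DY_def using prod_Y_pos[of 0] by simp
  have CZ: "0 < CZ" unfolding CZ_def by (intro prod_pos) (use negZ in force)
  have "(1 + x) ^ N * v x * (1 + x) \<le> C" if x: "0 \<le> x" for x
  proof -
    have "x powr (a + 1) \<le> (1 + x) powr (a + 1)" using x a by (intro powr_mono2) auto
    also have "\<dots> \<le> (1 + x) powr real K" using x a by (intro powr_mono) (auto simp: K_def)
    finally have 1: "x powr (a + 1) \<le> (1 + x) ^ K" using x by (simp add: powr_realpow)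
    have "(\<Prod>z\<in>Z. x - z) \<le> (\<Prod>z\<in>Z. (1 - z) * (1 + x))"
    proof (intro prod_mono)
      fix z assume "z \<in> Z"
      then have "z < 0" by (rule negZ)
      then have "z * x \<le> 0" using x by (simp add: mult_nonpos_nonneg)
      then show "0 \<le> x - z \<and> x - z \<le> (1 - z) * (1 + x)"
        using \<open>z < 0\<close> x by (simp add: algebra_simps)
    qed
    then have 2: "(\<Prod>z\<in>Z. x - z) \<le> CZ * (1 + x) ^ card Z" by (simp add: CZ_def prod.distrib)
    have 3: "DY \<le> (\<Prod>y\<in>Y. x - y)"
      unfolding DY_def by (intro prod_mono) (use negY x in force)
    have "((\<Prod>z\<in>Z. x - z) / (\<Prod>y\<in>Y. x - y))\<^sup>2 \<le> (CZ * (1 + x) ^ card Z / DY)\<^sup>2"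
      using x DY prod_Z_pos[OF x] prod_Y_pos[OF x] CZ 2 3
      by (intro power_mono frac_le divide_nonneg_pos) auto
    then have "v x \<le> (1 + x) ^ K * exp (- x) * (CZ * (1 + x) ^ card Z / DY)\<^sup>2"
      unfolding wt_def using x 1 by (intro mult_mono) auto
    then have E: "(1 + x) ^ N * v x * (1 + x) \<le> (1 + x) ^ N * ((1 + x) ^ K * exp (- x) * (CZ * (1 + x) ^ card Z / DY)\<^sup>2) * (1 + x)"
      using x by (intro mult_right_mono mult_left_mono) auto
    have M: "(1 + x) ^ M = (1 + x) ^ N * (1 + x) ^ K * (1 + x) * ((1 + x) ^ card Z)\<^sup>2"
      by (simp add: M_def power_add power_mult[symmetric] mult_ac)
    note E
    also have "(1 + x) ^ N * ((1 + x) ^ K * exp (- x) * (CZ * (1 + x) ^ card Z / DY)\<^sup>2) * (1 + x) = (CZ / DY)\<^sup>2 * ((1 + x) ^ M * exp (- x))"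
      unfolding M by (simp add: power2_eq_square field_simps)
    also have "\<dots> \<le> C"
    proof -
      have "(1 + x) ^ M / fact M \<le> exp (1 + x)" using x by (intro power_div_fact_le_exp) auto
      then have "(1 + x) ^ M \<le> fact M * exp 1 * exp x" by (simp add: exp_add field_simps)
      then have "(1 + x) ^ M * exp (- x) \<le> fact M * exp 1" by (simp add: exp_minus field_simps)
      then show ?thesis unfolding C_def by (intro mult_left_mono) auto
    qed
    finally show ?thesis .
  qed
  moreover have "0 < C" using CZ DY by (simp add: C_def)
  ultimately show ?thesis by (intro exI[of _ C]) (simp add: field_simps)
qed


text \<open>The inequality |x - y| <= (1 + x) (1 + y) for nonnegative x and y decouples the points;
  each index occurs in 2 (card I - 1) ordered pairs. The resulting one-variable factors are handled
  by \<open>v_growth\<close>.\<close>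

lemma wvandermonde_upper:
  assumes "finite I" and w: "\<And>i. i \<in> I \<Longrightarrow> 0 \<le> w i"
  shows "wvandermonde v I w \<le> (\<Prod>i\<in>I. (1 + w i) ^ (2 * (card I - 1)) * v (w i))"
proof -
  have "vandermonde I w \<le> (\<Prod>i\<in>I. \<Prod>j\<in>I - {i}. (1 + w i) * (1 + w j))"
    unfolding vandermonde_def
  proof (intro prod_mono conjI prod_nonneg)
    fix i j assume "i \<in> I" "j \<in> I - {i}"
    then have "0 \<le> w i" "0 \<le> w j" using w by auto
    moreover from this have "0 \<le> w i * w j" by simp
    ultimately show "\<bar>w i - w j\<bar> \<le> (1 + w i) * (1 + w j)" by (simp add: algebra_simps abs_le_iff)
  qed auto
  also have "\<dots> = (\<Prod>i\<in>I. \<Prod>j\<in>I - {i}. 1 + w i) * (\<Prod>i\<in>I. \<Prod>j\<in>I - {i}. 1 + w j)"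
    by (simp add: prod.distrib)
  also have "(\<Prod>i\<in>I. \<Prod>j\<in>I - {i}. 1 + w j) = (\<Prod>i\<in>I. \<Prod>j\<in>I - {i}. 1 + w i)"
    by (rule prod_offdiag_swap[OF assms(1)])
  also have "(\<Prod>i\<in>I. \<Prod>j\<in>I - {i}. 1 + w i) = (\<Prod>i\<in>I. (1 + w i) ^ (card I - 1))"
    using assms(1) by (intro prod.cong refl) (simp add: card_Diff_singleton)
  finally have "wvandermonde v I w \<le> (\<Prod>i\<in>I. (1 + w i) ^ (card I - 1)) * (\<Prod>i\<in>I. (1 + w i) ^ (card I - 1)) * (\<Prod>i\<in>I. v (w i))"
    unfolding wvandermonde_def by (intro mult_right_mono prod_nonneg) (auto simp: v_nonneg)
  also have "\<dots> = (\<Prod>i\<in>I. (1 + w i) ^ (2 * (card I - 1)) * v (w i))"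
    by (simp add: prod.distrib power_mult power2_eq_square mult_2 power_add)
  finally show ?thesis .
qed

lemma wvandermonde_pos:
  assumes "finite I" "\<And>i. i \<in> I \<Longrightarrow> 0 < w i" "inj_on w I"
  shows "0 < wvandermonde v I w"
  unfolding wvandermonde_def by (intro mult_pos_pos vandermonde_pos prod_pos ballI v_pos assms)

lemma wvandermonde_cong:
  "(\<And>i. i \<in> I \<Longrightarrow> w i = w' i) \<Longrightarrow> wvandermonde g I w = wvandermonde g I w'"
  unfolding wvandermonde_def vandermonde_def by (intro arg_cong2[where f = "(*)"] prod.cong) auto

lemma continuous_wvandermonde:
  "continuous_on {w. \<forall>i\<in>I. 0 \<le> w i} (wvandermonde v I)"
proof -
  have [continuous_intros]: "continuous_on A (\<lambda>w. w i)" for A :: "(nat \<Rightarrow> real) set" and i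
    by (rule continuous_on_subset[OF continuous_on_product_coordinates]) auto
  have "continuous_on {w. \<forall>i\<in>I. 0 \<le> w i} (\<lambda>w. v (w i))" if "i \<in> I" for i
    by (rule continuous_on_compose2[OF continuous_on_v]) (use that in \<open>auto intro!: continuous_intros\<close>)
  then show ?thesis unfolding wvandermonde_def vandermonde_def
    by (intro continuous_intros) auto
qed

text \<open>Compactness: a configuration with one far coordinate does no better than the explicit
  configuration \<open>w0\<close>, so the supremum is attained on a box. A zero coordinate or a
  coincidence makes the product vanish, hence neither occurs at the maximum.\<close>

lemma fekete_exists:
  assumes fin: "finite I"
  shows "\<exists>u. is_fekete v I u"
proof (cases "I = {}")
  case True
  then show ?thesis by (simp add: is_fekete_def wvandermonde_def vandermonde_def)
next
  case False
  define N where "N = 2 * (card I - 1)"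
  obtain C where C: "C > 0" and growth: "\<And>x. 0 \<le> x \<Longrightarrow> (1 + x) ^ N * v x \<le> C / (1 + x)"
    using v_growth[of N] by blast
  define w0 where "w0 = (\<lambda>i. if i \<in> I then real i + 1 else 0)"
  let ?F = "wvandermonde v I"
  have F0: "0 < ?F w0"
    by (rule wvandermonde_pos[OF fin]) (auto simp: w0_def inj_on_def)
  \<comment> \<open>Beyond \<open>K\<close> a single coordinate pushes the decoupled bound below the
    value at \<open>w0\<close>; the coordinates of \<open>w0\<close> are included so that
    \<open>w0\<close> itself lies in the box.\<close>
  define K where "K = Max (insert (C * C ^ (card I - 1) / ?F w0) (w0 ` I))"
  have K0: "w0 i \<le> K" if "i \<in> I" for i unfolding K_def using fin that by (intro Max_ge) auto
  have KC: "C * C ^ (card I - 1) / ?F w0 \<le> K" unfolding K_def using fin by (intro Max_ge) auto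
  have far: "?F w \<le> ?F w0" if w: "\<forall>i\<in>I. 0 < w i" and k: "k \<in> I" "K < w k" for w k
  proof -
    have "?F w \<le> (\<Prod>i\<in>I. (1 + w i) ^ N * v (w i))"
      unfolding N_def by (rule wvandermonde_upper[OF fin]) (use w in force)
    also have "\<dots> = ((1 + w k) ^ N * v (w k)) * (\<Prod>i\<in>I - {k}. (1 + w i) ^ N * v (w i))"
      by (rule prod.remove[OF fin k(1)])
    also have "\<dots> \<le> (C / (1 + w k)) * (\<Prod>i\<in>I - {k}. C)"
    proof (rule mult_mono)
      show "(1 + w k) ^ N * v (w k) \<le> C / (1 + w k)" using w k by (intro growth) force
      show "(\<Prod>i\<in>I - {k}. (1 + w i) ^ N * v (w i)) \<le> (\<Prod>i\<in>I - {k}. C)"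
      proof (intro prod_mono conjI)
        fix i assume "i \<in> I - {k}"
        then have i: "0 < w i" using w by auto
        then have "(1 + w i) ^ N * v (w i) \<le> C / (1 + w i)" by (intro growth) auto
        also have "\<dots> \<le> C" using i C by (simp add: field_simps)
        finally show "(1 + w i) ^ N * v (w i) \<le> C" .
        show "0 \<le> (1 + w i) ^ N * v (w i)" using i v_nonneg by simp
      qed
      show "0 \<le> C / (1 + w k)" using C w k by (intro divide_nonneg_pos) (auto simp: add_pos_pos)
      have "0 \<le> 1 + w i" if "i \<in> I" for i using w that by force
      then show "0 \<le> (\<Prod>i\<in>I - {k}. (1 + w i) ^ N * v (w i))"
        using v_nonneg by (intro prod_nonneg ballI mult_nonneg_nonneg zero_le_power) auto
    qed
    also have "\<dots> = C * C ^ (card I - 1) / (1 + w k)" using fin k by (simp add: card_Diff_singleton)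
    also have "\<dots> \<le> ?F w0"
    proof -
      have "C * C ^ (card I - 1) / ?F w0 \<le> 1 + w k" using KC k by linarith
      then show ?thesis using F0 w k by (simp add: field_simps add_pos_pos)
    qed
    finally show ?thesis .
  qed
  \<comment> \<open>Coordinates outside \<open>I\<close> are frozen at 0, which makes the box a
    product of compact sets and therefore compact in the space of all functions on the
    naturals.\<close>
  define B where "B = (PiE UNIV (\<lambda>i. if i \<in> I then {0..K} else {0}) :: (nat \<Rightarrow> real) set)"
  have "compactin (product_topology (\<lambda>_. euclidean) UNIV) B"
    unfolding B_def by (subst compactin_PiE) auto
  then have cpt: "compact B" by (simp add: euclidean_product_topology)
  have w0B: "w0 \<in> B" unfolding B_def using K0 by (auto simp: w0_def)
  have BI: "B \<subseteq> {w. \<forall>i\<in>I. 0 \<le> w i}" by (auto simp: B_def PiE_def Pi_def)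
  obtain u where u: "u \<in> B" and max: "\<And>w. w \<in> B \<Longrightarrow> ?F w \<le> ?F u"
    using continuous_attains_sup[OF cpt _ continuous_on_subset[OF continuous_wvandermonde BI]] w0B by blast
  have Fu: "0 < ?F u" using max[OF w0B] F0 by linarith
  have "0 < u i" if "i \<in> I" for i
  proof -
    have "0 \<le> u i" using u BI that by auto
    moreover have "u i \<noteq> 0"
    proof
      assume "u i = 0"
      then have "(\<Prod>i\<in>I. v (u i)) = 0" using that fin v_0 by (intro prod_zero) force+
      then show False using Fu by (simp add: wvandermonde_def)
    qed
    ultimately show ?thesis by simp
  qed
  moreover have "inj_on u I"
  proof (rule inj_onI, rule ccontr)
    fix i j assume "i \<in> I" "j \<in> I" "u i = u j" "i \<noteq> j"
    then have "(\<Prod>j\<in>I - {i}. \<bar>u i - u j\<bar>) = 0" using fin by (intro prod_zero) auto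
    then have "vandermonde I u = 0"
      unfolding vandermonde_def using \<open>i \<in> I\<close> fin by (intro prod_zero) blast+
    then show False using Fu by (simp add: wvandermonde_def)
  qed
  moreover have "?F w \<le> ?F u" if w: "\<forall>i\<in>I. 0 < w i" for w
  proof (cases "\<exists>k\<in>I. K < w k")
    case True
    then show ?thesis using far[OF w] max[OF w0B] by force
  next
    case False
    define w' where "w' = (\<lambda>i. if i \<in> I then w i else 0)"
    have "w' \<in> B" using w False by (auto simp: B_def w'_def not_less less_imp_le)
    moreover have "?F w = ?F w'" by (rule wvandermonde_cong) (simp add: w'_def)
    ultimately show ?thesis using max by simp
  qed
  ultimately show ?thesis unfolding is_fekete_def by blast
qed

text \<open>Isolates the dependence on one point. Each distance from that point occurs twice, so the
  factor is a square and differentiable in \<open>x\<close> even at collisions; this is also the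
  origin of the 2 in the equilibrium equations.\<close>

lemma vandermonde_update:
  assumes "finite I" "k \<in> I"
  shows "vandermonde I (u(k := x)) = vandermonde (I - {k}) u * (\<Prod>j\<in>I - {k}. x - u j)\<^sup>2"
proof -
  have "vandermonde I (u(k := x)) =
      (\<Prod>j\<in>I - {k}. \<bar>x - u j\<bar>) * (\<Prod>i\<in>I - {k}. \<Prod>j\<in>I - {i}. \<bar>u i - (u(k := x)) j\<bar>)"
    unfolding vandermonde_def prod.remove[OF assms] by (intro arg_cong2[where f = "(*)"] prod.cong) auto
  also have "(\<Prod>i\<in>I - {k}. \<Prod>j\<in>I - {i}. \<bar>u i - (u(k := x)) j\<bar>) =
      (\<Prod>i\<in>I - {k}. \<bar>x - u i\<bar> * (\<Prod>j\<in>I - {k} - {i}. \<bar>u i - u j\<bar>))"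
  proof (intro prod.cong refl)
    fix i assume i: "i \<in> I - {k}"
    have "(\<Prod>j\<in>I - {i}. \<bar>u i - (u(k := x)) j\<bar>) = \<bar>u i - x\<bar> * (\<Prod>j\<in>I - {i} - {k}. \<bar>u i - (u(k := x)) j\<bar>)"
      using i assms by (subst prod.remove[of _ k]) auto
    also have "(\<Prod>j\<in>I - {i} - {k}. \<bar>u i - (u(k := x)) j\<bar>) = (\<Prod>j\<in>I - {k} - {i}. \<bar>u i - u j\<bar>)"
      by (intro prod.cong) auto
    finally show "(\<Prod>j\<in>I - {i}. \<bar>u i - (u(k := x)) j\<bar>) = \<bar>x - u i\<bar> * (\<Prod>j\<in>I - {k} - {i}. \<bar>u i - u j\<bar>)"
      by (simp add: abs_minus_commute)
  qed
  also have "(\<Prod>j\<in>I - {k}. \<bar>x - u j\<bar>) * \<dots> = vandermonde (I - {k}) u * \<bar>\<Prod>j\<in>I - {k}. x - u j\<bar>\<^sup>2"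
    by (simp add: vandermonde_def prod.distrib abs_prod power2_eq_square mult_ac del: power2_abs)
  finally show ?thesis by (simp only: power2_abs)
qed

text \<open>Moving only the point with index \<open>k\<close> gives a positive multiple of the
  one-variable function \<open>f\<close>, which has an interior maximum at \<open>u k\<close>; its
  logarithmic derivative there is the equilibrium equation.\<close>

lemma fekete_stationary:
  assumes fin: "finite I" and u: "is_fekete v I u"
  shows "stationary I u (dlog_wt a Z Y)"
proof
  show "finite I" by fact
  show pos: "0 < u i" if "i \<in> I" for i using u that by (simp add: is_fekete_def)
  show inj: "inj_on u I" using u by (simp add: is_fekete_def)
  fix k assume k: "k \<in> I"
  define f where "f = (\<lambda>x. (\<Prod>j\<in>I - {k}. (x - u j)\<^sup>2) * v x)"
  define c where "c = vandermonde (I - {k}) u * (\<Prod>i\<in>I - {k}. v (u i))"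
  have F: "wvandermonde v I (u(k := x)) = c * f x" for x
  proof -
    have "(\<Prod>i\<in>I. v ((u(k := x)) i)) = v x * (\<Prod>i\<in>I - {k}. v (u i))"
      unfolding prod.remove[OF fin k] by (intro arg_cong2[where f = "(*)"] prod.cong) auto
    then show ?thesis
      by (simp add: wvandermonde_def vandermonde_update[OF fin k] c_def f_def prod_power_distrib mult_ac)
  qed
  have Fu: "0 < wvandermonde v I u" by (rule wvandermonde_pos[OF fin pos inj])
  have uk: "u(k := u k) = u" by simp
  have "0 \<le> c" unfolding c_def vandermonde_def by (intro mult_nonneg_nonneg prod_nonneg) (auto simp: v_nonneg)
  with Fu F[of "u k"] uk have c: "0 < c" by (metis less_eq_real_def mult_zero_left)
  have fu: "0 < f (u k)" using Fu F[of "u k"] uk c by (simp add: zero_less_mult_iff)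
  have "f x \<le> f (u k)" if "0 < x" for x
  proof -
    have "wvandermonde v I (u(k := x)) \<le> wvandermonde v I u"
      using u that by (simp add: is_fekete_def)
    then show ?thesis using F[of x] F[of "u k"] uk c by simp
  qed
  \<comment> \<open>The radius \<open>u k\<close> keeps the competing point on the positive
    axis.\<close>
  then have max: "\<forall>y. \<bar>u k - y\<bar> < u k \<longrightarrow> f y \<le> f (u k)" by fastforce
  have d: "((\<lambda>x. (x - u j)\<^sup>2) has_real_derivative (u k - u j)\<^sup>2 * (2 / (u k - u j))) (at (u k))" if "j \<in> I - {k}" for j
  proof -
    have "u k \<noteq> u j" using inj k that by (auto simp: inj_on_def)
    then show ?thesis by (auto intro!: derivative_eq_intros simp: power2_eq_square)
  qed
  have "(f has_real_derivative (\<Prod>j\<in>I - {k}. (u k - u j)\<^sup>2) * (v (u k) * dlog_wt a Z Y (u k)) +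
      (\<Prod>j\<in>I - {k}. (u k - u j)\<^sup>2) * (\<Sum>j\<in>I - {k}. 2 / (u k - u j)) * v (u k)) (at (u k))"
    unfolding f_def
    by (rule DERIV_mult'[OF prod_has_log_derivative v_log_derivative]) (use fin d pos k in auto)
  then have "(\<Prod>j\<in>I - {k}. (u k - u j)\<^sup>2) * (v (u k) * dlog_wt a Z Y (u k)) +
      (\<Prod>j\<in>I - {k}. (u k - u j)\<^sup>2) * (\<Sum>j\<in>I - {k}. 2 / (u k - u j)) * v (u k) = 0"
    using max pos[OF k] by (rule_tac DERIV_local_max)
  then have "f (u k) * ((\<Sum>j\<in>I - {k}. 2 / (u k - u j)) + dlog_wt a Z Y (u k)) = 0"
    by (simp add: f_def algebra_simps)
  then show "(\<Sum>j\<in>I - {k}. 2 / (u k - u j)) + dlog_wt a Z Y (u k) = 0" using fu by simp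
qed

end

subsection \<open>Zeros of Laguerre polynomials as Fekete points\<close>

lemma poly_prod_linear: "poly (\<Prod>i\<in>I. [:- u i, 1:]) x = (\<Prod>i\<in>I. x - u i)"
  for u :: "_ \<Rightarrow> real"
  by (simp add: poly_prod)

lemma monic_prod_linear:
  fixes u :: "_ \<Rightarrow> real"
  assumes "finite I"
  shows "degree (\<Prod>i\<in>I. [:- u i, 1:]) = card I" "coeff (\<Prod>i\<in>I. [:- u i, 1:]) (card I) = 1"
proof -
  have d: "degree (\<Prod>i\<in>I. [:- u i, 1:]) = card I"
    by (subst degree_prod_eq_sum_degree) auto
  have "lead_coeff (\<Prod>i\<in>I. [:- u i, 1:]) = 1" by (simp add: lead_coeff_prod)
  with d show "degree (\<Prod>i\<in>I. [:- u i, 1:]) = card I" "coeff (\<Prod>i\<in>I. [:- u i, 1:]) (card I) = 1" by auto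
qed

lemma poly_pderiv_prod_linear:
  fixes u :: "_ \<Rightarrow> real"
  assumes "finite I" "\<And>i. i \<in> I \<Longrightarrow> x \<noteq> u i"
  shows "poly (pderiv (\<Prod>i\<in>I. [:- u i, 1:])) x = (\<Prod>i\<in>I. x - u i) * (\<Sum>i\<in>I. 1 / (x - u i))"
proof -
  have "((\<lambda>x. \<Prod>i\<in>I. x - u i) has_real_derivative (\<Prod>i\<in>I. x - u i) * (\<Sum>i\<in>I. 1 / (x - u i))) (at x)"
    using assms by (intro prod_has_log_derivative) (auto intro!: derivative_eq_intros)
  moreover have "((\<lambda>x. \<Prod>i\<in>I. x - u i) has_real_derivative poly (pderiv (\<Prod>i\<in>I. [:- u i, 1:])) x) (at x)"
    using poly_DERIV[of "\<Prod>i\<in>I. [:- u i, 1:]" x] by (simp add: poly_prod)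
  ultimately show ?thesis by (rule DERIV_unique[symmetric])
qed

text \<open>With Q = (x - u_k) G one has Q' = G and Q'' = 2 G' at u_k. The second part translates
  the equilibrium sum into the ratio Q'' / Q', the bridge from maximizing points to a differential
  equation.\<close>

lemma pderiv_prod_linear_at_root:
  fixes u :: "_ \<Rightarrow> real"
  assumes fin: "finite I" and k: "k \<in> I" and inj: "inj_on u I"
  defines "Q \<equiv> \<Prod>i\<in>I. [:- u i, 1:]"
  shows "poly (pderiv Q) (u k) = (\<Prod>j\<in>I - {k}. u k - u j)"
    and "poly (pderiv (pderiv Q)) (u k) = poly (pderiv Q) (u k) * (\<Sum>j\<in>I - {k}. 2 / (u k - u j))"
proof -
  define G where "G = (\<Prod>j\<in>I - {k}. [:- u j, 1:])"
  have Q: "Q = [:- u k, 1:] * G" unfolding Q_def G_def by (rule prod.remove[OF fin k])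
  have d: "pderiv Q = G + [:- u k, 1:] * pderiv G" unfolding Q pderiv_mult by (simp add: pderiv_pCons)
  have dd: "pderiv (pderiv Q) = 2 * pderiv G + [:- u k, 1:] * pderiv (pderiv G)"
    unfolding d pderiv_add pderiv_mult by (simp add: pderiv_pCons)
  have G: "poly G (u k) = (\<Prod>j\<in>I - {k}. u k - u j)" by (simp add: G_def poly_prod)
  show 1: "poly (pderiv Q) (u k) = (\<Prod>j\<in>I - {k}. u k - u j)" by (simp add: d G)
  have "poly (pderiv G) (u k) = (\<Prod>j\<in>I - {k}. u k - u j) * (\<Sum>j\<in>I - {k}. 1 / (u k - u j))"
    unfolding G_def by (rule poly_pderiv_prod_linear) (use fin inj k in \<open>auto simp: inj_on_def\<close>)
  then show "poly (pderiv (pderiv Q)) (u k) = poly (pderiv Q) (u k) * (\<Sum>j\<in>I - {k}. 2 / (u k - u j))"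
    by (simp add: dd 1 sum_distrib_left mult_ac)
qed

lemma poly_zero_if_many_roots:
  fixes p :: "real poly"
  assumes "finite A" "\<And>x. x \<in> A \<Longrightarrow> poly p x = 0" "degree p < card A"
  shows "p = 0"
proof (rule ccontr)
  assume p: "p \<noteq> 0"
  have "card A \<le> card {x. poly p x = 0}" using assms p by (intro card_mono poly_roots_finite) auto
  also have "\<dots> \<le> degree p" using p by (rule card_poly_roots_bound)
  finally show False using assms(3) by simp
qed

section \<open>Fekete points of the classical weight and the Laguerre equation\<close>

definition monic_laguerre :: "nat \<Rightarrow> real \<Rightarrow> real poly" where
  "monic_laguerre n a = smult ((-1) ^ n * fact n) (laguerre n a)"

text \<open>Introduced as maximizing points, not as roots: existence of a maximizer then yields n
  distinct positive zeros of the Laguerre polynomial at once, and the equilibrium equations come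
  with them.\<close>

definition laguerre_points :: "nat \<Rightarrow> real \<Rightarrow> nat \<Rightarrow> real" where
  "laguerre_points n a = (SOME u. is_fekete (wt a {} {}) {1..n} u)"

lemma weight_classical: "-1 < a \<Longrightarrow> weight a {} {}"
  by unfold_locales auto

lemma dlog_wt_classical: "dlog_wt a {} {} = (\<lambda>x. (a + 1) / x - 1)"
  by (simp add: dlog_wt_def fun_eq_iff)

lemma ln_wt_classical: "0 < x \<Longrightarrow> ln (wt a {} {} x) = (a + 1) * ln x - x"
  by (simp add: wt_def ln_mult_pos)

lemma is_fekete_laguerre_points: "-1 < a \<Longrightarrow> is_fekete (wt a {} {}) {1..n} (laguerre_points n a)"
  unfolding laguerre_points_def
  by (rule someI_ex[of "is_fekete (wt a {} {}) {1..n}"]) (rule weight.fekete_exists[OF weight_classical], auto)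

lemma stationary_laguerre_points:
  "-1 < a \<Longrightarrow> stationary {1..n} (laguerre_points n a) (\<lambda>x. (a + 1) / x - 1)"
  using weight.fekete_stationary[OF weight_classical _ is_fekete_laguerre_points]
  by (simp add: dlog_wt_classical)

text \<open>The recurrence determines the coefficients downwards from index \<open>n\<close>, since
  the factor i - n does not vanish for i < n.\<close>

lemma laguerre_coeff_unique:
  fixes p :: "real poly"
  assumes a: "-1 < a" and deg: "degree p = n" and lead: "coeff p n = coeff q n" and degq: "degree q \<le> n"
    and p: "\<And>i. (real i + 1) * (real i + a + 1) * coeff p (Suc i) = (real i - real n) * coeff p i"
    and q: "\<And>i. (real i + 1) * (real i + a + 1) * coeff q (Suc i) = (real i - real n) * coeff q i"
  shows "p = q"
proof (rule poly_eqI)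
  fix i
  show "coeff p i = coeff q i"
  proof (cases "i \<le> n")
    case True
    then show ?thesis
    proof (induction rule: inc_induct)
      case (step i)
      then have "(real i - real n) * coeff p i = (real i - real n) * coeff q i" using p[of i] q[of i] by simp
      then show ?case using step by simp
    qed (fact lead)
  qed (use deg degq in \<open>simp add: coeff_eq_0\<close>)
qed

lemma laguerre_ode_coeff:
  fixes p :: "real poly"
  assumes "[:0, 1:] * pderiv (pderiv p) + [:a + 1, -1:] * pderiv p + smult (real n) p = 0"
  shows "(real i + 1) * (real i + a + 1) * coeff p (Suc i) = (real i - real n) * coeff p i"
proof -
  have "coeff ([:0, 1:] * pderiv (pderiv p) + [:a + 1, -1:] * pderiv p + smult (real n) p) i = 0"
    using assms by simp
  then show ?thesis by (cases i) (simp_all add: coeff_pderiv algebra_simps)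
qed

text \<open>Stieltjes' argument: by equilibrium, x Q'' + (a + 1 - x) Q' vanishes at every root of Q,
  and adding n Q cancels the coefficient of degree n. The result has degree below n but n distinct
  zeros, so it is 0, and Q satisfies the Laguerre equation with leading coefficient 1.\<close>

lemma monic_laguerre_eq_prod:
  assumes a: "-1 < a"
  shows "monic_laguerre n a = (\<Prod>i\<in>{1..n}. [:- laguerre_points n a i, 1:])"
proof -
  define u where "u = laguerre_points n a"
  define Q where "Q = (\<Prod>i\<in>{1..n}. [:- u i, 1:])"
  interpret stationary "{1..n}" u "\<lambda>x. (a + 1) / x - 1"
    unfolding u_def by (rule stationary_laguerre_points[OF a])
  have Q: "degree Q = n" "coeff Q n = 1" using monic_prod_linear[of "{1..n}" u] by (auto simp: Q_def)
  define D where "D = [:0, 1:] * pderiv (pderiv Q) + [:a + 1, -1:] * pderiv Q + smult (real n) Q"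
  have roots: "poly D x = 0" if "x \<in> u ` {1..n}" for x
  proof -
    obtain k where k: "k \<in> {1..n}" "x = u k" using \<open>x \<in> u ` {1..n}\<close> by auto
    have "poly Q (u k) = 0" unfolding Q_def poly_prod_linear using k by (intro prod_zero) auto
    moreover have "poly (pderiv (pderiv Q)) (u k) = - poly (pderiv Q) (u k) * ((a + 1) / u k - 1)"
    proof -
      have "(\<Sum>j\<in>{1..n} - {k}. 2 / (u k - u j)) = - ((a + 1) / u k - 1)" using stat[OF k(1)] by linarith
      then show ?thesis
        using pderiv_prod_linear_at_root(2)[OF fin k(1) inj] unfolding Q_def by (metis mult_minus_left mult_minus_right)
    qed
    ultimately show ?thesis using pos[OF k(1)] by (simp add: D_def k field_simps)
  qed
  have "D = 0"
  proof (cases "n = 0")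
    case True then show ?thesis using Q by (simp add: D_def Q_def)
  next
    case False
    have "coeff D i = 0" if "n \<le> i" for i
    proof -
      have "coeff Q (Suc i) = 0" "coeff Q (Suc (Suc i)) = 0" "i > n \<Longrightarrow> coeff Q i = 0" using that Q by (auto intro!: coeff_eq_0)
      then show ?thesis using that unfolding D_def by (cases i; cases "i = n") (simp_all add: coeff_pderiv algebra_simps)
    qed
    then have "degree D < n" using False by (metis degree_0 gr0I leI leading_coeff_0_iff)
    moreover have "card (u ` {1..n}) = n" using card_image[OF inj] by simp
    ultimately show ?thesis using roots by (intro poly_zero_if_many_roots[of "u ` {1..n}"]) auto
  qed
  then have 1: "(real i + 1) * (real i + a + 1) * coeff Q (Suc i) = (real i - real n) * coeff Q i" for i
    unfolding D_def by (rule laguerre_ode_coeff)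
  have 2: "(real i + 1) * (real i + a + 1) * coeff (monic_laguerre n a) (Suc i) =
      (real i - real n) * coeff (monic_laguerre n a) i" for i
    using coeff_laguerre_rec[of i a n] by (simp add: monic_laguerre_def)
  have "Q = monic_laguerre n a"
  proof (rule laguerre_coeff_unique[OF a Q(1) _ _ 1 2])
    show "coeff Q n = coeff (monic_laguerre n a) n"
      by (simp add: Q monic_laguerre_def coeff_laguerre power_mult_distrib[symmetric] flip: power_add)
    show "degree (monic_laguerre n a) \<le> n" by (simp add: monic_laguerre_def)
  qed
  then show ?thesis by (simp add: Q_def u_def)
qed

section \<open>Lowering relation and three-term recurrence\<close>

lemma laguerre_lower:
  assumes "0 < n"
  shows "smult (real n + a) (laguerre (n - 1) a) = smult (real n) (laguerre n a) - [:0, 1:] * pderiv (laguerre n a)"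
proof (rule poly_eqI)
  fix i
  have A: "(real n + a) * coeff (laguerre (n - 1) a) i = (real n - real i) * coeff (laguerre n a) i"
  proof (cases "i < n")
    case True
    define j where "j = n - 1 - i"
    have n: "n = Suc (i + j)" using True by (simp add: j_def)
    have "(real n + a) * ((real (n - 1) + a) gchoose j) = (real j + 1) * ((real n + a) gchoose Suc j)"
      using gbinomial_absorption'[of "Suc j" "real n + a"] by (simp add: n field_simps)
    then have "(real n + a) * ((real (n - 1) + a) gchoose (n - 1 - i)) = (real n - real i) * ((real n + a) gchoose (n - i))"
      by (simp add: n Suc_diff_le)
    then show ?thesis using True by (simp add: coeff_laguerre)
  qed (use assms in \<open>auto simp: coeff_laguerre\<close>)
  then show "coeff (smult (real n + a) (laguerre (n - 1) a)) i = coeff (smult (real n) (laguerre n a) - [:0, 1:] * pderiv (laguerre n a)) i"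
    by (cases i) (simp_all add: coeff_pderiv algebra_simps)
qed

lemma monic_laguerre_lower:
  assumes "0 < n"
  shows "x * poly (pderiv (monic_laguerre n a)) x =
    real n * poly (monic_laguerre n a) x + real n * (real n + a) * poly (monic_laguerre (n - 1) a) x"
proof -
  obtain k where n: "n = Suc k" using assms gr0_implies_Suc by blast
  have "(real n + a) * poly (laguerre k a) x = real n * poly (laguerre n a) x - x * poly (pderiv (laguerre n a)) x"
    using arg_cong[OF laguerre_lower[OF assms, of a], of "\<lambda>p. poly p x"] by (simp add: n)
  then have L: "x * poly (pderiv (laguerre n a)) x = real n * poly (laguerre n a) x - (real n + a) * poly (laguerre k a) x"
    by simp
  have "x * poly (pderiv (monic_laguerre n a)) x = (-1) ^ n * fact n * (x * poly (pderiv (laguerre n a)) x)"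
    by (simp add: monic_laguerre_def pderiv_smult)
  also have "\<dots> = real n * poly (monic_laguerre n a) x + real n * (real n + a) * poly (monic_laguerre k a) x"
    unfolding L by (simp add: monic_laguerre_def n algebra_simps)
  finally show ?thesis by (simp add: n)
qed

text \<open>The derivative of the lowering relation together with the differential equation
  expresses x L_{n-1}' by L_n and L_{n-1}. The lowering relation one degree below then eliminates
  that derivative in favour of L_{n-2}.\<close>

lemma monic_laguerre_rec:
  assumes "-1 < a" "2 \<le> n"
  shows "poly (monic_laguerre n a) x = (x - (2 * real n - 1 + a)) * poly (monic_laguerre (n - 1) a) x
    - (real n - 1) * (real n - 1 + a) * poly (monic_laguerre (n - 2) a) x"
proof -
  define L where "L = laguerre n a"
  define M where "M = laguerre (n - 1) a"
  have na: "real n + a \<noteq> 0" using assms by linarith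
  have M: "smult (real n + a) M = smult (real n) L - [:0, 1:] * pderiv L"
    unfolding L_def M_def by (rule laguerre_lower) (use assms in auto)
  have "smult (real n + a) (pderiv M) = smult (real n) (pderiv L) - pderiv L - [:0, 1:] * pderiv (pderiv L)"
    using arg_cong[OF M, of pderiv] by (simp add: pderiv_smult pderiv_diff pderiv_mult pderiv_pCons)
  then have "poly (smult (real n + a) (pderiv M)) x =
      poly (smult (real n) (pderiv L) - pderiv L - [:0, 1:] * pderiv (pderiv L)) x" by (simp only:)
  then have dM: "(real n + a) * poly (pderiv M) x = (real n - 1) * poly (pderiv L) x - x * poly (pderiv (pderiv L)) x"
    by (simp add: algebra_simps)
  have M': "(real n + a) * poly M x = real n * poly L x - x * poly (pderiv L) x"
    using arg_cong[OF M, of "\<lambda>p. poly p x"] by simp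
  have ode: "x * poly (pderiv (pderiv L)) x + (a + 1 - x) * poly (pderiv L) x + real n * poly L x = 0"
    using arg_cong[OF laguerre_ode[of n a], of "\<lambda>p. poly p x"] unfolding L_def by (simp add: algebra_simps)
  have "(real n + a) * (x * poly (pderiv M) x) = (real n + a) * (real n * poly L x - (real n + a - x) * poly M x)"
    using dM M' ode by algebra
  then have 1: "x * poly (pderiv M) x = real n * poly L x - (real n + a - x) * poly M x" using na by simp
  have 2: "(real n - 1 + a) * poly (laguerre (n - 2) a) x = (real n - 1) * poly M x - x * poly (pderiv M) x"
    using arg_cong[OF laguerre_lower[of "n - 1" a], of "\<lambda>p. poly p x"] assms(2)
    unfolding M_def by (simp add: of_nat_diff numeral_2_eq_2)
  obtain k where n: "n = Suc (Suc k)" using assms(2) by (metis add_2_eq_Suc le_Suc_ex)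
  have "real n * poly L x = (2 * real n - 1 + a - x) * poly M x - (real n - 1 + a) * poly (laguerre (n - 2) a) x"
    using 1 2 by algebra
  then have "(-1) ^ n * fact (n - 1) * (real n * poly L x) = (-1) ^ n * fact (n - 1) *
     ((2 * real n - 1 + a - x) * poly M x - (real n - 1 + a) * poly (laguerre (n - 2) a) x)" by simp
  then show ?thesis by (simp add: monic_laguerre_def L_def M_def n algebra_simps)
qed

section \<open>Discriminant and energy of the Laguerre zeros\<close>

definition laguerre_energy :: "nat \<Rightarrow> real \<Rightarrow> real" where
  "laguerre_energy n a = ln (wvandermonde (wt a {} {}) {1..n} (laguerre_points n a))"

lemma laguerre_points_pos: "-1 < a \<Longrightarrow> i \<in> {1..n} \<Longrightarrow> 0 < laguerre_points n a i"
  and inj_laguerre_points: "-1 < a \<Longrightarrow> inj_on (laguerre_points n a) {1..n}"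
  using is_fekete_laguerre_points by (auto simp: is_fekete_def)

lemma poly_monic_laguerre:
  "-1 < a \<Longrightarrow> poly (monic_laguerre n a) x = (\<Prod>i\<in>{1..n}. x - laguerre_points n a i)"
  by (simp add: monic_laguerre_eq_prod poly_prod_linear)

text \<open>Schur's evaluation of the discriminant: the recurrences turn the derivatives at the zeros
  into values of the preceding polynomial, and swapping the two products lowers the degree.\<close>

lemma laguerre_resultant_rec:
  assumes a: "-1 < a" and n: "2 \<le> n"
  defines "R \<equiv> \<lambda>n. \<Prod>i\<in>{1..n}. \<bar>poly (monic_laguerre (n - 1) a) (laguerre_points n a i)\<bar>"
  shows "R n = ((real n - 1) * (real n - 1 + a)) ^ (n - 1) * R (n - 1)"
proof -
  let ?u = "laguerre_points n a" and ?t = "laguerre_points (n - 1) a"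
  have "R n = (\<Prod>i\<in>{1..n}. \<Prod>j\<in>{1..n - 1}. \<bar>?u i - ?t j\<bar>)"
    by (simp add: R_def poly_monic_laguerre[OF a] abs_prod)
  also have "\<dots> = (\<Prod>j\<in>{1..n - 1}. \<Prod>i\<in>{1..n}. \<bar>?t j - ?u i\<bar>)"
    by (subst prod.swap) (simp add: abs_minus_commute)
  also have "\<dots> = (\<Prod>j\<in>{1..n - 1}. \<bar>poly (monic_laguerre n a) (?t j)\<bar>)"
    by (simp add: poly_monic_laguerre[OF a] abs_prod)
  also have "\<dots> = (\<Prod>j\<in>{1..n - 1}. ((real n - 1) * (real n - 1 + a)) * \<bar>poly (monic_laguerre (n - 2) a) (?t j)\<bar>)"
  proof (intro prod.cong refl)
    fix j assume "j \<in> {1..n - 1}"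
    then have "poly (monic_laguerre (n - 1) a) (?t j) = 0"
      unfolding poly_monic_laguerre[OF a] by (intro prod_zero) auto
    then have "poly (monic_laguerre n a) (?t j) = - (((real n - 1) * (real n - 1 + a)) * poly (monic_laguerre (n - 2) a) (?t j))"
      unfolding monic_laguerre_rec[OF a n] by simp
    moreover have "0 \<le> (real n - 1) * (real n - 1 + a)" using n a by (intro mult_nonneg_nonneg) auto
    ultimately show "\<bar>poly (monic_laguerre n a) (?t j)\<bar> =
        ((real n - 1) * (real n - 1 + a)) * \<bar>poly (monic_laguerre (n - 2) a) (?t j)\<bar>"
      by (simp only: abs_minus_cancel abs_of_nonneg abs_mult[of "(real n - 1) * (real n - 1 + a)" "poly _ _"])
  qed
  also have "\<dots> = ((real n - 1) * (real n - 1 + a)) ^ (n - 1) * R (n - 1)"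
    by (simp add: prod.distrib R_def numeral_2_eq_2)
  finally show ?thesis .
qed

text \<open>All zeros are positive, so their product is the absolute value of the monic polynomial
  at 0; there the derivative term of the lowering relation disappears.\<close>

lemma prod_laguerre_points_rec:
  assumes a: "-1 < a" and n: "1 \<le> n"
  shows "(\<Prod>i\<in>{1..n}. laguerre_points n a i) = (real n + a) * (\<Prod>i\<in>{1..n - 1}. laguerre_points (n - 1) a i)"
proof -
  have P: "(\<Prod>i\<in>{1..k}. laguerre_points k a i) = \<bar>poly (monic_laguerre k a) 0\<bar>" for k
    unfolding poly_monic_laguerre[OF a] abs_prod
    by (intro prod.cong refl) (use laguerre_points_pos[OF a, of _ k] in force)
  have "real n * (poly (monic_laguerre n a) 0 + (real n + a) * poly (monic_laguerre (n - 1) a) 0) = 0"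
    using monic_laguerre_lower[of n 0 a] n by (simp add: algebra_simps)
  then have "poly (monic_laguerre n a) 0 + (real n + a) * poly (monic_laguerre (n - 1) a) 0 = 0" using n by simp
  then have "poly (monic_laguerre n a) 0 = - ((real n + a) * poly (monic_laguerre (n - 1) a) 0)" by linarith
  moreover have "0 \<le> real n + a" using n a by linarith
  ultimately show ?thesis unfolding P by (simp add: abs_mult)
qed

lemma sum_laguerre_points:
  assumes a: "-1 < a"
  shows "(\<Sum>i\<in>{1..n}. laguerre_points n a i) = real n * (real n + a)"
proof -
  interpret stationary "{1..n}" "laguerre_points n a" "\<lambda>x. (a + 1) / x - 1"
    by (rule stationary_laguerre_points[OF a])
  have "(\<Sum>i\<in>{1..n}. laguerre_points n a i * ((a + 1) / laguerre_points n a i - 1)) =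
      (\<Sum>i\<in>{1..n}. (a + 1) - laguerre_points n a i)"
    using pos by (intro sum.cong refl) (force simp: field_simps)
  then show ?thesis using sum_mult_h by (simp add: sum_subtractf algebra_simps)
qed

text \<open>At a zero the lowering relation reads u_i Q'(u_i) = n (n + a) Q_{n-1}(u_i). Its factor
  u_i accounts for the product of the zeros on the left.\<close>

lemma vandermonde_laguerre_points:
  assumes a: "-1 < a" and n: "1 \<le> n"
  shows "vandermonde {1..n} (laguerre_points n a) * (\<Prod>i\<in>{1..n}. laguerre_points n a i) =
    (real n * (real n + a)) ^ n * (\<Prod>i\<in>{1..n}. \<bar>poly (monic_laguerre (n - 1) a) (laguerre_points n a i)\<bar>)"
proof -
  let ?u = "laguerre_points n a"
  have "vandermonde {1..n} ?u * (\<Prod>i\<in>{1..n}. ?u i) = (\<Prod>i\<in>{1..n}. (\<Prod>j\<in>{1..n} - {i}. \<bar>?u i - ?u j\<bar>) * ?u i)"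
    by (simp add: vandermonde_def prod.distrib)
  also have "\<dots> = (\<Prod>i\<in>{1..n}. (real n * (real n + a)) * \<bar>poly (monic_laguerre (n - 1) a) (?u i)\<bar>)"
  proof (intro prod.cong refl)
    fix i assume i: "i \<in> {1..n}"
    have z: "poly (monic_laguerre n a) (?u i) = 0"
      unfolding poly_monic_laguerre[OF a] using i by (intro prod_zero) auto
    have "poly (pderiv (monic_laguerre n a)) (?u i) = (\<Prod>j\<in>{1..n} - {i}. ?u i - ?u j)"
      unfolding monic_laguerre_eq_prod[OF a]
      by (rule pderiv_prod_linear_at_root(1)[OF _ i inj_laguerre_points[OF a]]) simp
    then have "?u i * (\<Prod>j\<in>{1..n} - {i}. ?u i - ?u j) = real n * (real n + a) * poly (monic_laguerre (n - 1) a) (?u i)"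
      using monic_laguerre_lower[of n "?u i" a] n z by simp
    then have "\<bar>?u i * (\<Prod>j\<in>{1..n} - {i}. ?u i - ?u j)\<bar> = \<bar>real n * (real n + a) * poly (monic_laguerre (n - 1) a) (?u i)\<bar>"
      by simp
    moreover have "0 < ?u i" by (rule laguerre_points_pos[OF a i])
    moreover have "0 \<le> real n + a" using n a by linarith
    ultimately show "(\<Prod>j\<in>{1..n} - {i}. \<bar>?u i - ?u j\<bar>) * ?u i = real n * (real n + a) * \<bar>poly (monic_laguerre (n - 1) a) (?u i)\<bar>"
      by (simp add: abs_mult abs_prod mult_ac)
  qed
  also have "\<dots> = (real n * (real n + a)) ^ n * (\<Prod>i\<in>{1..n}. \<bar>poly (monic_laguerre (n - 1) a) (?u i)\<bar>)"
    by (simp add: prod.distrib)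
  finally show ?thesis .
qed

text \<open>The energy in degree k is k ln (k (k + a)) + ln R_k + a ln P_k - k (k + a), where R is
  the resultant and P the product of the zeros: one unit of the weight exponent a + 1 is used up by
  P in the discriminant formula. The recursion for R supplies precisely the logarithm that occurs in
  degree n - 1, so it cancels and elementary terms remain.\<close>

lemma laguerre_energy_diff:
  assumes a: "-1 < a" and n: "2 \<le> n"
  shows "laguerre_energy n a - laguerre_energy (n - 1) a =
    real n * ln (real n) + (real n + a) * ln (real n + a) - 2 * real n + 1 - a"
proof -
  define R where "R = (\<lambda>n. \<Prod>i\<in>{1..n}. \<bar>poly (monic_laguerre (n - 1) a) (laguerre_points n a i)\<bar>)"
  define P where "P = (\<lambda>n. \<Prod>i\<in>{1..n}. laguerre_points n a i)"
  have P: "0 < P k" for k unfolding P_def by (intro prod_pos) (auto intro!: laguerre_points_pos[OF a])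
  have na: "0 < real k + a" if "1 \<le> k" for k using that a by linarith
  have V: "0 < vandermonde {1..k} (laguerre_points k a)" for k
    by (rule vandermonde_pos[OF inj_laguerre_points[OF a]])
  have VP: "vandermonde {1..k} (laguerre_points k a) * P k = (real k * (real k + a)) ^ k * R k" if "1 \<le> k" for k
    using vandermonde_laguerre_points[OF a that] by (simp add: P_def R_def)
  have R: "0 < R k" if "1 \<le> k" for k
  proof -
    have "0 < (real k * (real k + a)) ^ k * R k" using VP[OF that] V P by (metis mult_pos_pos)
    moreover have "0 < (real k * (real k + a)) ^ k" using that na[OF that] by simp
    ultimately show ?thesis by (rule zero_less_mult_pos)
  qed
  have E: "laguerre_energy k a = k * ln (real k * (real k + a)) + ln (R k) + a * ln (P k) - real k * (real k + a)"
    if "1 \<le> k" for k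
  proof -
    have wt: "0 < wt a {} {} (laguerre_points k a i)" if "i \<in> {1..k}" for i
      using laguerre_points_pos[OF a that] by (rule weight.v_pos[OF weight_classical[OF a]])
    have "laguerre_energy k a = ln (vandermonde {1..k} (laguerre_points k a)) + (\<Sum>i\<in>{1..k}. ln (wt a {} {} (laguerre_points k a i)))"
      unfolding laguerre_energy_def wvandermonde_def
      using ln_mult_pos[OF V[of k] prod_pos[of "{1..k}" "\<lambda>i. wt a {} {} (laguerre_points k a i)"]] wt
      by (subst ln_prod[symmetric]) force+
    also have "(\<Sum>i\<in>{1..k}. ln (wt a {} {} (laguerre_points k a i))) =
       (\<Sum>i\<in>{1..k}. (a + 1) * ln (laguerre_points k a i) - laguerre_points k a i)"
      by (intro sum.cong refl ln_wt_classical laguerre_points_pos[OF a])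
    also have "\<dots> = (a + 1) * ln (P k) - real k * (real k + a)"
    proof -
      have "ln (P k) = (\<Sum>i\<in>{1..k}. ln (laguerre_points k a i))"
        unfolding P_def by (intro ln_prod laguerre_points_pos[OF a, THEN less_imp_neq, symmetric]) auto
      then show ?thesis by (simp only: sum_subtractf sum_distrib_left[symmetric] sum_laguerre_points[OF a])
    qed
    also have "ln (vandermonde {1..k} (laguerre_points k a)) = k * ln (real k * (real k + a)) + ln (R k) - ln (P k)"
    proof -
      have "ln (vandermonde {1..k} (laguerre_points k a)) + ln (P k) = ln ((real k * (real k + a)) ^ k) + ln (R k)"
        using ln_mult_pos[OF V P, of k k] ln_mult_pos[of "(real k * (real k + a)) ^ k" "R k"] VP[OF that]
          R[OF that] na[OF that] that by simp
      then show ?thesis using that na[OF that] by (simp add: ln_realpow)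
    qed
    finally show ?thesis by (simp add: algebra_simps)
  qed
  have n1: "real (n - 1) = real n - 1" using n by simp
  have "R n = ((real n - 1) * (real n - 1 + a)) ^ (n - 1) * R (n - 1)"
    unfolding R_def by (rule laguerre_resultant_rec[OF a n])
  then have lnR: "ln (R n) = (real n - 1) * ln ((real n - 1) * (real n - 1 + a)) + ln (R (n - 1))"
    using R[of "n - 1"] n na[of "n - 1"] by (simp add: ln_mult_pos ln_realpow n1)
  have "P n = (real n + a) * P (n - 1)" unfolding P_def by (rule prod_laguerre_points_rec[OF a]) (use n in simp)
  then have lnP: "ln (P n) = ln (real n + a) + ln (P (n - 1))"
    using P[of "n - 1"] n na[of n] by (simp add: ln_mult_pos)
  have lnn: "ln (real n * (real n + a)) = ln (real n) + ln (real n + a)" using n na[of n] by (simp add: ln_mult_pos)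
  show ?thesis
  proof -
    define X where "X = ln ((real n - 1) * (real n - 1 + a))"
    have "laguerre_energy (n - 1) a = (real n - 1) * X + ln (R (n - 1)) + a * ln (P (n - 1)) - (real n - 1) * (real n - 1 + a)"
      using E[of "n - 1"] n unfolding n1 X_def by simp
    moreover have "laguerre_energy n a = real n * (ln (real n) + ln (real n + a)) +
        ((real n - 1) * X + ln (R (n - 1))) + a * (ln (real n + a) + ln (P (n - 1))) - real n * (real n + a)"
      using E[of n] n unfolding lnn lnR lnP X_def by simp
    ultimately show ?thesis by (simp add: algebra_simps)
  qed
qed

subsection \<open>Exceptional Laguerre polynomials\<close>

definition S_zeros :: "nat \<Rightarrow> real \<Rightarrow> real set" where
  "S_zeros m \<alpha> = (\<lambda>i. - laguerre_points m (\<alpha> - 1) i) ` {1..m}"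

text \<open>The classical representation L_m^(\<alpha>)(-x) L_n^(\<alpha>-1)(x) +
  L_m^(\<alpha>-1)(-x) L_{n-1}^(\<alpha>)(x), rewritten by L_m^(\<alpha>)(-x) = S + S' and
  L_{n-1}^(\<alpha>) = - (L_n^(\<alpha>-1))'. Only the parameter \<alpha> - 1 remains, and n = 0
  needs no separate case.\<close>

definition xlaguerre_sol :: "nat \<Rightarrow> real \<Rightarrow> nat \<Rightarrow> real poly" where
  "xlaguerre_sol m \<alpha> n = (let S = xlaguerre_S m \<alpha>; L = laguerre n (\<alpha> - 1)
     in (S + pderiv S) * L - S * pderiv L)"

lemma laguerre_eq_prod:
  assumes "-1 < a"
  shows "laguerre n a = smult ((-1) ^ n / fact n) (\<Prod>i\<in>{1..n}. [:- laguerre_points n a i, 1:])"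
  using monic_laguerre_eq_prod[OF assms, of n, symmetric]
  by (simp add: monic_laguerre_def flip: power_add mult_2)

lemma S_zeros:
  assumes "0 < \<alpha>"
  shows "finite (S_zeros m \<alpha>)" "card (S_zeros m \<alpha>) = m" "y \<in> S_zeros m \<alpha> \<Longrightarrow> y < 0"
    and poly_xlaguerre_S: "poly (xlaguerre_S m \<alpha>) x = (\<Prod>y\<in>S_zeros m \<alpha>. x - y) / fact m"
proof -
  have a: "-1 < \<alpha> - 1" using assms by simp
  note inj = inj_laguerre_points[OF a, of m]
  then have inj': "inj_on (\<lambda>i. - laguerre_points m (\<alpha> - 1) i) {1..m}"
    unfolding inj_on_def neg_equal_iff_equal .
  show "finite (S_zeros m \<alpha>)" by (simp add: S_zeros_def)
  show "card (S_zeros m \<alpha>) = m" unfolding S_zeros_def using card_image[OF inj'] by simp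
  show "y \<in> S_zeros m \<alpha> \<Longrightarrow> y < 0" using laguerre_points_pos[OF a] by (auto simp: S_zeros_def)
  have "poly (xlaguerre_S m \<alpha>) x = (-1) ^ m / fact m * (\<Prod>i\<in>{1..m}. - laguerre_points m (\<alpha> - 1) i - x)"
    by (simp add: xlaguerre_S_def poly_pcompose laguerre_eq_prod[OF a] poly_prod)
  also have "(\<Prod>i\<in>{1..m}. - laguerre_points m (\<alpha> - 1) i - x) = (\<Prod>i\<in>{1..m}. (-1) * (x + laguerre_points m (\<alpha> - 1) i))"
    by (intro prod.cong) auto
  also have "\<dots> = (-1) ^ m * (\<Prod>i\<in>{1..m}. x + laguerre_points m (\<alpha> - 1) i)"
    unfolding prod.distrib by simp
  also have "(\<Prod>i\<in>{1..m}. x + laguerre_points m (\<alpha> - 1) i) = (\<Prod>y\<in>S_zeros m \<alpha>. x - y)"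
    unfolding S_zeros_def by (subst prod.reindex[OF inj']) simp
  finally show "poly (xlaguerre_S m \<alpha>) x = (\<Prod>y\<in>S_zeros m \<alpha>. x - y) / fact m"
    by (simp flip: power_add mult_2)
qed

lemma degree_xlaguerre_S: "degree (xlaguerre_S m \<alpha>) = m"
  and coeff_xlaguerre_S: "coeff (xlaguerre_S m \<alpha>) m = 1 / fact m"
proof -
  show d: "degree (xlaguerre_S m \<alpha>) = m" by (simp add: xlaguerre_S_def degree_pcompose)
  have "lead_coeff (xlaguerre_S m \<alpha>) = lead_coeff (laguerre m (\<alpha> - 1)) * (-1) ^ m"
    unfolding xlaguerre_S_def by (subst lead_coeff_comp) auto
  then show "coeff (xlaguerre_S m \<alpha>) m = 1 / fact m"
    unfolding lead_coeff_laguerre d by (simp flip: power_add mult_2)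
qed

lemma xlaguerre_S_ode:
  "[:0, 1:] * pderiv (pderiv (xlaguerre_S m \<alpha>)) + [:\<alpha>, 1:] * pderiv (xlaguerre_S m \<alpha>)
    - smult (real m) (xlaguerre_S m \<alpha>) = 0"
proof -
  let ?L = "laguerre m (\<alpha> - 1)"
  have d: "pderiv (pcompose p [:0, -1:]) = - pcompose (pderiv p) [:0, -1:]" for p :: "real poly"
    by (simp add: pderiv_pcompose pderiv_pCons)
  show ?thesis
  proof (rule poly_eq_poly_eq_iff[THEN iffD1], rule ext)
    fix x
    have "poly ([:0, 1:] * pderiv (pderiv ?L) + [:\<alpha> - 1 + 1, -1:] * pderiv ?L + smult (real m) ?L) (- x) = 0"
      unfolding laguerre_ode by simp
    then show "poly ([:0, 1:] * pderiv (pderiv (xlaguerre_S m \<alpha>)) + [:\<alpha>, 1:] * pderiv (xlaguerre_S m \<alpha>)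
      - smult (real m) (xlaguerre_S m \<alpha>)) x = poly 0 x"
      unfolding xlaguerre_S_def d pderiv_minus by (simp add: poly_pcompose algebra_simps)
  qed
qed

lemma coeff_mult_degree_le:
  fixes p q :: "'a::comm_semiring_0 poly"
  assumes "degree p \<le> i" "degree q \<le> j"
  shows "coeff (p * q) (i + j) = coeff p i * coeff q j"
proof (cases "degree p = i \<and> degree q = j")
  case True then show ?thesis using coeff_mult_degree_sum[of p q] by auto
next
  case False
  then have "degree (p * q) < i + j" using degree_mult_le[of p q] assms by linarith
  then show ?thesis using False assms by (auto simp: coeff_eq_0)
qed

lemma degree_xlaguerre_sol: "degree (xlaguerre_sol m \<alpha> n) = m + n"
  and lead_coeff_xlaguerre_sol: "lead_coeff (xlaguerre_sol m \<alpha> n) = (-1) ^ n / (fact m * fact n)"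
proof -
  define S where "S = xlaguerre_S m \<alpha>"
  define L where "L = laguerre n (\<alpha> - 1)"
  have S: "degree S = m" "coeff S m = 1 / fact m" by (simp_all add: S_def degree_xlaguerre_S coeff_xlaguerre_S)
  have L: "degree L = n" "coeff L n = (-1) ^ n / fact n" by (simp_all add: L_def coeff_laguerre)
  have dS: "degree (S + pderiv S) \<le> m" "coeff (S + pderiv S) m = 1 / fact m"
    using S degree_pderiv[of S] by (auto intro!: degree_add_le simp: coeff_pderiv coeff_eq_0)
  have dL: "degree (pderiv L) \<le> n" "coeff (pderiv L) n = 0"
    using L degree_pderiv[of L] by (auto simp: coeff_pderiv coeff_eq_0)
  have y: "xlaguerre_sol m \<alpha> n = (S + pderiv S) * L - S * pderiv L"
    by (simp add: xlaguerre_sol_def S_def L_def Let_def)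
  have c: "coeff (xlaguerre_sol m \<alpha> n) (m + n) = (-1) ^ n / (fact m * fact n)"
    unfolding y coeff_diff using dS dL S L by (subst (1 2) coeff_mult_degree_le) auto
  have "degree (xlaguerre_sol m \<alpha> n) \<le> m + n"
    unfolding y using degree_mult_le[of "S + pderiv S" L] degree_mult_le[of S "pderiv L"] dS dL S L
    by (intro degree_diff_le) linarith+
  moreover have "m + n \<le> degree (xlaguerre_sol m \<alpha> n)" by (rule le_degree) (simp add: c)
  ultimately show d: "degree (xlaguerre_sol m \<alpha> n) = m + n" by simp
  show "lead_coeff (xlaguerre_sol m \<alpha> n) = (-1) ^ n / (fact m * fact n)" unfolding d by (rule c)
qed

text \<open>The exceptional equation cleared of denominators by the factor x S, so that it can be
  treated as an identity of polynomials.\<close>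

definition xlaguerre_op :: "nat \<Rightarrow> real \<Rightarrow> nat \<Rightarrow> real poly \<Rightarrow> real poly" where
  "xlaguerre_op m \<alpha> n y =
     xlaguerre_S m \<alpha> * ([:0, 1:] * pderiv (pderiv y) + [:\<alpha> + 1, -1:] * pderiv y + smult (real m + real n) y)
     - pderiv (xlaguerre_S m \<alpha>) * ([:0, 2:] * pderiv y + smult (2 * \<alpha>) y)"

lemma xlaguerre_ode_iff:
  assumes "x \<noteq> 0" "poly (xlaguerre_S m \<alpha>) x \<noteq> 0"
  shows "poly (pderiv (pderiv y)) x
        + ((\<alpha> + 1 - x) / x - 2 * poly (pderiv (xlaguerre_S m \<alpha>)) x / poly (xlaguerre_S m \<alpha>) x) * poly (pderiv y) x
        + ((real m + real n) / x - \<alpha> / x * (2 * poly (pderiv (xlaguerre_S m \<alpha>)) x / poly (xlaguerre_S m \<alpha>) x)) * poly y x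
       = poly (xlaguerre_op m \<alpha> n y) x / (x * poly (xlaguerre_S m \<alpha>) x)"
  using assms by (simp add: xlaguerre_op_def field_simps)

text \<open>The cleared equation for the solution is a combination, with explicit polynomial
  multipliers, of the second-order equations of \<open>S\<close> and \<open>L\<close> and of their
  derivatives; these four expressions vanish.\<close>

lemma xlaguerre_op_sol: "xlaguerre_op m \<alpha> n (xlaguerre_sol m \<alpha> n) = 0"
proof -
  define S where "S = xlaguerre_S m \<alpha>"
  define L where "L = laguerre n (\<alpha> - 1)"
  \<comment> \<open>Scalars become constant polynomials, so the whole verification takes place in
    one commutative ring.\<close>
  define X where "X = [:0, 1::real:]"
  define A where "A = [:\<alpha>:]"
  define M where "M = [:real m:]"
  define N where "N = [:real n:]"
  define S1 where "S1 = pderiv S"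
  define S2 where "S2 = pderiv S1"
  define S3 where "S3 = pderiv S2"
  define L1 where "L1 = pderiv L"
  define L2 where "L2 = pderiv L1"
  define L3 where "L3 = pderiv L2"
  note d = S1_def[symmetric] S2_def[symmetric] S3_def[symmetric] L1_def[symmetric] L2_def[symmetric] L3_def[symmetric]
  have dX: "pderiv X = 1" "pderiv A = 0" "pderiv M = 0" "pderiv N = 0"
    by (simp_all add: X_def A_def M_def N_def pderiv_pCons)
  have s: "X * S2 + (A + X) * S1 - M * S = 0"
    using xlaguerre_S_ode[of m \<alpha>] by (simp add: X_def A_def M_def S2_def S1_def S_def)
  have l: "X * L2 + (A - X) * L1 + N * L = 0"
    using laguerre_ode[of n "\<alpha> - 1"] by (simp add: X_def A_def N_def L2_def L1_def L_def)
  have s': "S2 + X * S3 + S1 + (A + X) * S2 - M * S1 = 0"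
    using arg_cong[OF s, of pderiv] by (simp add: pderiv_add pderiv_diff pderiv_mult dX d algebra_simps)
  have l': "L2 + X * L3 - L1 + (A - X) * L2 + N * L1 = 0"
    using arg_cong[OF l, of pderiv] by (simp add: pderiv_add pderiv_diff pderiv_mult dX d algebra_simps)
  define y where "y = (S + S1) * L - S * L1"
  have y1: "pderiv y = (S1 + S2) * L + S * L1 - S * L2"
    by (simp add: y_def pderiv_add pderiv_diff pderiv_mult d algebra_simps)
  have y2: "pderiv (pderiv y) = (S2 + S3) * L + (S1 + S2) * L1 + S1 * L1 + S * L2 - S1 * L2 - S * L3"
    unfolding y1 by (simp add: pderiv_add pderiv_diff pderiv_mult d algebra_simps)
  have "xlaguerre_op m \<alpha> n y =
     S * (X * pderiv (pderiv y) + (A + 1 - X) * pderiv y + (M + N) * y) - S1 * (2 * X * pderiv y + 2 * A * y)"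
    unfolding xlaguerre_op_def S1_def S_def
    by (simp add: X_def A_def M_def N_def numeral_poly one_pCons smult_add_left algebra_simps)
  also have "\<dots> = 0"
  proof -
    have "S * (X * pderiv (pderiv y) + (A + 1 - X) * pderiv y + (M + N) * y) - S1 * (2 * X * pderiv y + 2 * A * y) =
        S * L * (S2 + X * S3 + S1 + (A + X) * S2 - M * S1) - S * S * (L2 + X * L3 - L1 + (A - X) * L2 + N * L1)
        + (S * L1 - S * L - 2 * S1 * L) * (X * S2 + (A + X) * S1 - M * S)
        + (S * S + S * S1) * (X * L2 + (A - X) * L1 + N * L)"
      unfolding y2 unfolding y1 unfolding y_def by algebra
    then show ?thesis by (simp add: s l s' l')
  qed
  finally show ?thesis
    by (simp add: y_def xlaguerre_sol_def S_def L_def S1_def L1_def Let_def)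
qed

lemma is_xlaguerre_op:
  assumes "is_xlaguerre m \<alpha> n y"
  shows "xlaguerre_op m \<alpha> n y = 0"
proof (rule ccontr)
  assume "xlaguerre_op m \<alpha> n y \<noteq> 0"
  moreover have "xlaguerre_S m \<alpha> \<noteq> 0" using coeff_xlaguerre_S[of m \<alpha>] by auto
  ultimately have "finite ({0} \<union> {x. poly (xlaguerre_S m \<alpha>) x = 0} \<union> {x. poly (xlaguerre_op m \<alpha> n y) x = 0})"
    by (simp add: poly_roots_finite)
  moreover have "x \<in> {0} \<union> {x. poly (xlaguerre_S m \<alpha>) x = 0} \<union> {x. poly (xlaguerre_op m \<alpha> n y) x = 0}" for x
    using assms xlaguerre_ode_iff[of x m \<alpha> y n] unfolding is_xlaguerre_def by force
  ultimately have "finite (UNIV :: real set)" by (metis finite_subset subsetI)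
  then show False using infinite_UNIV_char_0 by blast
qed

lemma xlaguerre_op_diff: "xlaguerre_op m \<alpha> n (y - z) = xlaguerre_op m \<alpha> n y - xlaguerre_op m \<alpha> n z"
  by (simp add: xlaguerre_op_def pderiv_diff smult_diff_right algebra_simps)

lemma xlaguerre_op_eq_0:
  assumes "xlaguerre_op m \<alpha> n y = 0" "y \<noteq> 0"
  shows "degree y = m + n"
proof -
  let ?k = "degree y" and ?S = "xlaguerre_S m \<alpha>"
  define A where "A = [:0, 1:] * pderiv (pderiv y) + [:\<alpha> + 1, -1:] * pderiv y + smult (real m + real n) y"
  define B where "B = [:0, 2:] * pderiv y + smult (2 * \<alpha>) y"
  have A: "coeff A i = (real i + 1) * (real i + \<alpha> + 1) * coeff y (Suc i) + (real m + real n - real i) * coeff y i" for i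
    unfolding A_def by (cases i) (simp_all add: coeff_pderiv algebra_simps)
  have B: "coeff B i = (2 * real i + 2 * \<alpha>) * coeff y i" for i
    unfolding B_def by (cases i) (simp_all add: coeff_pderiv algebra_simps)
  have dA: "degree A \<le> ?k" by (rule degree_le) (simp add: A coeff_eq_0)
  have dB: "degree B \<le> ?k" by (rule degree_le) (simp add: B coeff_eq_0)
  have "coeff (pderiv ?S) m = 0" by (simp add: coeff_pderiv coeff_eq_0 degree_xlaguerre_S)
  moreover have "degree (pderiv ?S) \<le> m" using degree_pderiv[of ?S] by (simp add: degree_xlaguerre_S)
  ultimately have "coeff (pderiv ?S * B) (m + ?k) = 0" using coeff_mult_degree_le[OF _ dB] by simp
  moreover have "coeff (?S * A) (m + ?k) = 1 / fact m * coeff A ?k"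
    using coeff_mult_degree_le[OF _ dA, of ?S m] by (simp add: degree_xlaguerre_S coeff_xlaguerre_S)
  moreover have "coeff (?S * A - pderiv ?S * B) (m + ?k) = 0"
    using assms(1) unfolding xlaguerre_op_def A_def B_def by simp
  ultimately have "coeff A ?k = 0" by simp
  then have "real m + real n - real ?k = 0" using assms(2) by (simp add: A coeff_eq_0)
  then show ?thesis by linarith
qed

text \<open>Two solutions share the coefficient of degree m + n, so their difference has none there,
  whereas \<open>xlaguerre_op_eq_0\<close> would give a nonzero difference exactly that
  degree.\<close>

lemma xlaguerre_eq: "xlaguerre m \<alpha> n = xlaguerre_sol m \<alpha> n"
  unfolding xlaguerre_def
proof (rule the_equality)
  show sol: "is_xlaguerre m \<alpha> n (xlaguerre_sol m \<alpha> n)"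
    unfolding is_xlaguerre_def
    using xlaguerre_ode_iff[of _ m \<alpha> "xlaguerre_sol m \<alpha> n" n] xlaguerre_op_sol[of m \<alpha> n]
      degree_xlaguerre_sol[of m \<alpha> n] lead_coeff_xlaguerre_sol[of m \<alpha> n] by simp
  fix y assume y: "is_xlaguerre m \<alpha> n y"
  show "y = xlaguerre_sol m \<alpha> n"
  proof (rule ccontr)
    let ?d = "y - xlaguerre_sol m \<alpha> n"
    assume "y \<noteq> xlaguerre_sol m \<alpha> n"
    moreover have "xlaguerre_op m \<alpha> n ?d = 0"
      by (simp add: xlaguerre_op_diff xlaguerre_op_sol is_xlaguerre_op[OF y])
    ultimately have "degree ?d = m + n" by (intro xlaguerre_op_eq_0) auto
    moreover have "coeff y (m + n) = (-1) ^ n / (fact m * fact n)"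
      using y unfolding is_xlaguerre_def by metis
    then have "coeff ?d (m + n) = 0"
      using degree_xlaguerre_sol[of m \<alpha> n] lead_coeff_xlaguerre_sol[of m \<alpha> n] by simp
    ultimately have "?d = 0" by (metis leading_coeff_0_iff)
    then show False using \<open>y \<noteq> xlaguerre_sol m \<alpha> n\<close> by simp
  qed
qed

lemma xlaguerre_nonzero: "xlaguerre m \<alpha> n \<noteq> 0"
  using lead_coeff_xlaguerre_sol[of m \<alpha> n] unfolding xlaguerre_eq by force

section \<open>Number of regular and exceptional zeros\<close>

lemma poly_xlaguerre:
  "poly (xlaguerre m \<alpha> n) x =
    (poly (xlaguerre_S m \<alpha>) x + poly (pderiv (xlaguerre_S m \<alpha>)) x) * poly (laguerre n (\<alpha> - 1)) x
    - poly (xlaguerre_S m \<alpha>) x * poly (pderiv (laguerre n (\<alpha> - 1))) x"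
  by (simp add: xlaguerre_eq xlaguerre_sol_def Let_def)

lemma poly_xlaguerre_S_pos:
  assumes "0 < \<alpha>" "0 \<le> x" shows "0 < poly (xlaguerre_S m \<alpha>) x"
  unfolding poly_xlaguerre_S[OF assms(1)]
  by (intro divide_pos_pos prod_pos) (use S_zeros(3)[OF assms(1)] assms(2) in force)+

lemma poly_laguerre:
  assumes "-1 < a"
  shows "poly (laguerre n a) x = (-1) ^ n / fact n * (\<Prod>i\<in>{1..n}. x - laguerre_points n a i)"
  unfolding laguerre_eq_prod[OF assms] by (simp add: poly_prod)

lemma poly_laguerre_pos_neg:
  assumes "-1 < a" "x < 0" shows "0 < poly (laguerre n a) x"
proof -
  have "0 < (\<Prod>i\<in>{1..n}. laguerre_points n a i - x)"
    by (intro prod_pos) (use laguerre_points_pos[OF assms(1)] assms(2) in force)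
  also have "(\<Prod>i\<in>{1..n}. laguerre_points n a i - x) = (\<Prod>i\<in>{1..n}. (-1) * (x - laguerre_points n a i))"
    by (intro prod.cong) auto
  also have "\<dots> = (-1) ^ n * (\<Prod>i\<in>{1..n}. x - laguerre_points n a i)" unfolding prod.distrib by simp
  finally show ?thesis unfolding poly_laguerre[OF assms(1)] by (simp add: field_simps)
qed

text \<open>On the positive axis, the solution is a nonvanishing multiple of the derivative of
  \<open>exp (- x) * L / S\<close>, so Rolle's theorem provides a zero after each zero of \<open>L\<close> except the last.\<close>

lemma xlaguerre_zero_after:
  assumes \<alpha>: "0 < \<alpha>" and k: "k \<in> {1..n}"
  defines "u \<equiv> laguerre_points n (\<alpha> - 1)"
  shows "\<exists>z>u k. poly (xlaguerre m \<alpha> n) z = 0 \<and> (\<forall>j\<in>{1..n}. u j \<le> u k \<or> z < u j)"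
proof -
  define S where "S = xlaguerre_S m \<alpha>"
  define L where "L = laguerre n (\<alpha> - 1)"
  let ?y = "xlaguerre m \<alpha> n"
  have a: "-1 < \<alpha> - 1" using \<alpha> by simp
  have upos: "0 < u i" if "i \<in> {1..n}" for i unfolding u_def by (rule laguerre_points_pos[OF a that])
  have inj: "inj_on u {1..n}" unfolding u_def by (rule inj_laguerre_points[OF a])
  have Spos: "0 < poly S x" if "0 \<le> x" for x unfolding S_def by (rule poly_xlaguerre_S_pos[OF \<alpha> that])
  have y: "poly ?y x = (poly S x + poly (pderiv S) x) * poly L x - poly S x * poly (pderiv L) x" for x
    unfolding S_def L_def by (rule poly_xlaguerre)
  have Lroot: "poly L (u i) = 0" if "i \<in> {1..n}" for i
  proof -
    have "(\<Prod>j\<in>{1..n}. u i - u j) = 0" using that by (intro prod_zero) auto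
    then show ?thesis unfolding L_def poly_laguerre[OF a] u_def[symmetric] by simp
  qed
  show ?thesis
  proof (cases "\<exists>j\<in>{1..n}. u k < u j")
    case True
    define b where "b = Min {x \<in> u ` {1..n}. u k < x}"
    have "finite {x \<in> u ` {1..n}. u k < x}" "{x \<in> u ` {1..n}. u k < x} \<noteq> {}" using True by auto
    then have b: "b \<in> u ` {1..n}" "u k < b" and bmin: "\<And>x. x \<in> u ` {1..n} \<Longrightarrow> u k < x \<Longrightarrow> b \<le> x"
      unfolding b_def using Min_in Min_le by blast+
    define \<phi> where "\<phi> = (\<lambda>x. exp (- x) * poly L x / poly S x)"
    have der: "(\<phi> has_real_derivative - exp (- x) * poly ?y x / (poly S x)\<^sup>2) (at x)" if "0 \<le> x" for x
      unfolding \<phi>_def y using Spos[OF that]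
      by (auto intro!: derivative_eq_intros simp: power2_eq_square field_simps)
    have "\<exists>z>u k. z < b \<and> DERIV \<phi> z :> 0"
    proof (rule Rolle[OF b(2)])
      show "\<phi> (u k) = \<phi> b" using Lroot b(1) k by (auto simp: \<phi>_def)
      show "continuous_on {u k..b} \<phi>"
      proof (intro continuous_at_imp_continuous_on ballI)
        fix x assume "x \<in> {u k..b}"
        then have "0 \<le> x" using upos[OF k] by simp
        then show "isCont \<phi> x" by (rule DERIV_isCont[OF der])
      qed
      show "\<phi> differentiable (at x)" if "u k < x" for x
        using der[of x] upos[OF k] that by (auto simp: real_differentiable_def)
    qed
    then obtain z where z: "u k < z" "z < b" "DERIV \<phi> z :> 0" by blast
    have "0 \<le> z" using z upos[OF k] by simp
    then have "- exp (- z) * poly ?y z / (poly S z)\<^sup>2 = 0" using DERIV_unique[OF der z(3)] by simp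
    then have "poly ?y z = 0" using Spos[OF \<open>0 \<le> z\<close>] by simp
    moreover have "\<forall>j\<in>{1..n}. u j \<le> u k \<or> z < u j" using bmin z by fastforce
    ultimately show ?thesis using z(1) by blast
  next
    case False
    \<comment> \<open>After the last zero of \<open>L\<close> Rolle's theorem does not apply.
      Multiplied by \<open>c\<close>, the solution has a positive leading coefficient, while at
      \<open>u k\<close> it equals - S c L', which is negative since all other zeros lie to the
      left; the intermediate value theorem gives a zero.\<close>
    define c :: real where "c = (-1) ^ n / fact n"
    have c: "0 < c * c" by (simp add: c_def)
    have "0 < (\<Prod>j\<in>{1..n} - {k}. u k - u j)"
    proof (intro prod_pos)
      fix j assume j: "j \<in> {1..n} - {k}"
      then have "u j \<noteq> u k" using inj_onD[OF inj] k by blast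
      moreover have "u j \<le> u k" using j False by (auto simp: not_less)
      ultimately show "0 < u k - u j" by simp
    qed
    moreover have "poly (pderiv L) (u k) = c * (\<Prod>j\<in>{1..n} - {k}. u k - u j)"
      unfolding L_def laguerre_eq_prod[OF a] pderiv_smult poly_smult u_def[symmetric]
        pderiv_prod_linear_at_root(1)[OF finite_atLeastAtMost k inj] c_def ..
    ultimately have "0 < c * poly (pderiv L) (u k)" using c by (simp add: mult.assoc[symmetric])
    then have neg: "poly (smult c ?y) (u k) < 0"
      using mult_pos_pos[OF Spos[of "u k"]] upos[OF k] Lroot[OF k] by (simp add: y mult.left_commute[of c])
    have "lead_coeff (smult c ?y) = c * c / fact m"
      using lead_coeff_xlaguerre_sol[of m \<alpha> n] by (simp add: xlaguerre_eq c_def)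
    then have "0 < lead_coeff (smult c ?y)" using c by simp
    then obtain M where M: "\<And>x. M \<le> x \<Longrightarrow> lead_coeff (smult c ?y) \<le> poly (smult c ?y) x" "0 < lead_coeff (smult c ?y)"
      using poly_pinfty_gt_lc by blast
    define b where "b = max M (u k + 1)"
    have "0 < poly (smult c ?y) b" using M(1)[of b] M(2) by (simp add: b_def)
    then have "\<exists>z>u k. z < b \<and> poly (smult c ?y) z = 0"
      using neg by (intro poly_IVT_pos) (auto simp: b_def)
    moreover have "c \<noteq> 0" by (simp add: c_def)
    ultimately obtain z where "u k < z" "poly ?y z = 0" by auto
    then show ?thesis using False by (intro exI[of _ z]) (auto simp: not_less)
  qed
qed

text \<open>The zero found after \<open>u k\<close> lies before the next larger zero of
  \<open>L\<close>, so different \<open>k\<close> give different zeros. This lower bound serves to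
  cap the number of exceptional zeros through the degree m + n.\<close>

lemma card_regular_zeros:
  assumes \<alpha>: "0 < \<alpha>"
  shows "n \<le> card {z. 0 < z \<and> poly (xlaguerre m \<alpha> n) z = 0}"
proof -
  define u where "u = laguerre_points n (\<alpha> - 1)"
  have a: "-1 < \<alpha> - 1" using \<alpha> by simp
  have upos: "0 < u i" if "i \<in> {1..n}" for i unfolding u_def by (rule laguerre_points_pos[OF a that])
  have inj: "inj_on u {1..n}" unfolding u_def by (rule inj_laguerre_points[OF a])
  have "\<forall>k\<in>{1..n}. \<exists>z. u k < z \<and> poly (xlaguerre m \<alpha> n) z = 0 \<and> (\<forall>j\<in>{1..n}. u j \<le> u k \<or> z < u j)"
    using xlaguerre_zero_after[OF \<alpha>] unfolding u_def by blast
  from bchoice[OF this] obtain g where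
    "\<forall>k\<in>{1..n}. u k < g k \<and> poly (xlaguerre m \<alpha> n) (g k) = 0 \<and> (\<forall>j\<in>{1..n}. u j \<le> u k \<or> g k < u j)" ..
  then have g: "\<And>k. k \<in> {1..n} \<Longrightarrow> u k < g k"
      "\<And>k. k \<in> {1..n} \<Longrightarrow> poly (xlaguerre m \<alpha> n) (g k) = 0"
      "\<And>k j. k \<in> {1..n} \<Longrightarrow> j \<in> {1..n} \<Longrightarrow> u j \<le> u k \<or> g k < u j"
    by blast+
  have "inj_on g {1..n}"
  proof (rule inj_onI)
    fix i j assume ij: "i \<in> {1..n}" "j \<in> {1..n}" "g i = g j"
    have "u i = u j" using g(1)[OF ij(1)] g(1)[OF ij(2)] g(3)[OF ij(1,2)] g(3)[OF ij(2,1)] ij(3) by linarith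
    then show "i = j" using inj ij by (meson inj_onD)
  qed
  then have "n = card (g ` {1..n})" by (simp add: card_image)
  also have "\<dots> \<le> card {z. 0 < z \<and> poly (xlaguerre m \<alpha> n) z = 0}"
  proof (rule card_mono)
    show "finite {z. 0 < z \<and> poly (xlaguerre m \<alpha> n) z = 0}"
      using poly_roots_finite[OF xlaguerre_nonzero] by (rule finite_subset[rotated]) auto
    show "g ` {1..n} \<subseteq> {z. 0 < z \<and> poly (xlaguerre m \<alpha> n) z = 0}" using g upos by force
  qed
  finally show ?thesis .
qed

lemma exceptional_zeros_finite: "finite (exceptional_zeros m \<alpha> n)"
  and exceptional_zeros_neg: "z \<in> exceptional_zeros m \<alpha> n \<Longrightarrow> z < 0"
  using poly_roots_finite[OF xlaguerre_nonzero[of m \<alpha> n]]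
  by (auto simp: exceptional_zeros_def intro: finite_subset[rotated])

lemma card_exceptional_zeros_le:
  assumes "0 < \<alpha>" shows "card (exceptional_zeros m \<alpha> n) \<le> m"
proof -
  let ?R = "{z. 0 < z \<and> poly (xlaguerre m \<alpha> n) z = 0}" and ?A = "{z. poly (xlaguerre m \<alpha> n) z = 0}"
  have fin: "finite ?A" by (rule poly_roots_finite[OF xlaguerre_nonzero])
  have "card (exceptional_zeros m \<alpha> n) + card ?R = card (exceptional_zeros m \<alpha> n \<union> ?R)"
    by (intro card_Un_disjoint[symmetric] exceptional_zeros_finite finite_subset[OF _ fin]) (auto simp: exceptional_zeros_def)
  also have "\<dots> \<le> card ?A" by (intro card_mono fin) (auto simp: exceptional_zeros_def)
  also have "\<dots> \<le> degree (xlaguerre m \<alpha> n)" by (rule card_poly_roots_bound[OF xlaguerre_nonzero])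
  also have "\<dots> = m + n" by (simp add: xlaguerre_eq degree_xlaguerre_sol)
  finally show ?thesis using card_regular_zeros[OF assms, of n m] by linarith
qed

subsection \<open>Convergence of the exceptional zeros\<close>

text \<open>Partial fractions turn \<open>sum_shifted_h\<close> into n <= b W^2 + (\<alpha> + b) W
  for the sum W on the right. The constant depends only on \<open>K\<close>, since the bound is
  applied with b = -x for varying x near a zero of \<open>S\<close>.\<close>

lemma laguerre_points_sum_lower:
  assumes "0 < \<alpha>" "0 < b" "b \<le> K" "1 \<le> n"
  shows "sqrt n / (1 + 2 * K + \<alpha>) \<le> (\<Sum>i\<in>{1..n}. 1 / (b + laguerre_points n (\<alpha> - 1) i))"
proof -
  define u where "u = laguerre_points n (\<alpha> - 1)"
  define W where "W = (\<Sum>i\<in>{1..n}. 1 / (b + u i))"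
  define s where "s = sqrt n"
  define c where "c = 1 / (1 + 2 * K + \<alpha>)"
  have "-1 < \<alpha> - 1" using assms by simp
  from stationary_laguerre_points[OF this, of n] interpret stationary "{1..n}" u "\<lambda>x. \<alpha> / x - 1"
    unfolding u_def by simp
  have W0: "0 \<le> W" unfolding W_def using pos assms by (intro sum_nonneg) (force simp: add_pos_pos less_imp_le)
  have inv: "(\<Sum>i\<in>{1..n}. \<alpha> / u i) = n" using sum_h by (simp add: sum_subtractf)
  have "(\<Sum>k\<in>{1..n}. (\<alpha> / u k - 1) / (b + u k)) = (\<Sum>k\<in>{1..n}. (\<alpha> / u k) / b - \<alpha> / b * (1 / (b + u k)) - 1 / (b + u k))"
  proof (intro sum.cong refl)
    fix k assume "k \<in> {1..n}"
    then have "0 < u k" by (rule pos)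
    then show "(\<alpha> / u k - 1) / (b + u k) = (\<alpha> / u k) / b - \<alpha> / b * (1 / (b + u k)) - 1 / (b + u k)"
      using assms by (simp add: divide_simps) (simp add: algebra_simps)
  qed
  also have "\<dots> = n / b - \<alpha> / b * W - W"
    by (simp only: sum_subtractf sum_distrib_left[symmetric] sum_divide_distrib[symmetric] inv W_def)
  finally have "n / b - \<alpha> / b * W - W = W\<^sup>2 - (\<Sum>k\<in>{1..n}. 1 / (b + u k)\<^sup>2)"
    using sum_shifted_h[of b] assms unfolding W_def by simp
  moreover have "0 \<le> (\<Sum>k\<in>{1..n}. 1 / (b + u k)\<^sup>2)" by (intro sum_nonneg) simp
  ultimately have "n / b - \<alpha> / b * W - W \<le> W\<^sup>2" by linarith
  then have "b * (n / b - \<alpha> / b * W - W) \<le> b * W\<^sup>2" using assms by (intro mult_left_mono) auto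
  then have 1: "n \<le> b * W\<^sup>2 + (\<alpha> + b) * W" using assms by (simp add: algebra_simps)
  have s: "1 \<le> s" "s\<^sup>2 = n" using assms by (auto simp: s_def)
  have c: "0 < c" "c \<le> 1" using assms by (auto simp: c_def)
  \<comment> \<open>With c <= 1 and s >= 1 the quadratic and the linear term are both bounded by
    multiples of c s^2, in total (\<alpha> + 2 K) c s^2, and \<open>c\<close> is chosen to make
    (\<alpha> + 2 K) c less than 1.\<close>
  have "\<not> W < c * s"
  proof
    assume lt: "W < c * s"
    have "W\<^sup>2 \<le> (c * s)\<^sup>2" using lt W0 by (intro power_mono) auto
    also have "\<dots> \<le> c * s\<^sup>2"
    proof -
      have "c * (c * s\<^sup>2) \<le> 1 * (c * s\<^sup>2)" using c by (intro mult_right_mono) auto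
      then show ?thesis by (simp add: power2_eq_square mult_ac)
    qed
    finally have A: "b * W\<^sup>2 \<le> K * (c * s\<^sup>2)" using assms by (intro mult_mono) auto
    have "c * s * 1 \<le> c * s * s" using s c by (intro mult_left_mono) auto
    then have "W \<le> c * s * s" using lt by simp
    then have B: "(\<alpha> + b) * W \<le> (\<alpha> + K) * (c * s\<^sup>2)" using assms W0 by (intro mult_mono) (auto simp: power2_eq_square)
    have "n \<le> (\<alpha> + 2 * K) * c * s\<^sup>2" using 1 A B by (simp add: algebra_simps)
    moreover have "(\<alpha> + 2 * K) * c < 1" using assms by (simp add: c_def field_simps)
    then have "(\<alpha> + 2 * K) * c * s\<^sup>2 < 1 * s\<^sup>2" using s assms by (intro mult_strict_right_mono) auto
    ultimately show False using s by simp
  qed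
  then show ?thesis by (simp add: W_def u_def c_def s_def)
qed

text \<open>On the negative axis the solution is \<open>L * (S + S' + S * W)\<close> with \<open>W = - L' / L\<close> of order at
  least \<open>sqrt n\<close>, so its sign near a simple zero of \<open>S\<close> is that of \<open>S\<close>.\<close>

lemma xlaguerre_zero_near:
  assumes \<alpha>: "0 < \<alpha>" and \<zeta>: "\<zeta> \<in> S_zeros m \<alpha>"
  shows "\<exists>C>0. \<forall>\<^sub>F n in sequentially. \<exists>z<0. poly (xlaguerre m \<alpha> n) z = 0 \<and> \<bar>z - \<zeta>\<bar> \<le> C / sqrt n"
proof -
  define S where "S = xlaguerre_S m \<alpha>"
  define q where "q = poly (pderiv S) \<zeta>"
  have a: "-1 < \<alpha> - 1" using \<alpha> by simp
  note fin = S_zeros(1)[OF \<alpha>, of m]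
  have neg: "\<zeta> < 0" by (rule S_zeros(3)[OF \<alpha> \<zeta>])
  have "poly S = poly (smult (1 / fact m) (\<Prod>y\<in>S_zeros m \<alpha>. [:- y, 1:]))"
    by (simp add: fun_eq_iff S_def poly_xlaguerre_S[OF \<alpha>] poly_prod)
  then have Sprod: "S = smult (1 / fact m) (\<Prod>y\<in>S_zeros m \<alpha>. [:- y, 1:])" by (rule poly_eq_poly_eq_iff[THEN iffD1])
  have "q = (\<Prod>y\<in>S_zeros m \<alpha> - {\<zeta>}. \<zeta> - y) / fact m"
    unfolding q_def Sprod pderiv_smult using pderiv_prod_linear_at_root(1)[OF fin \<zeta>, of "\<lambda>x. x"] by simp
  then have q: "q \<noteq> 0" using fin by auto
  have S0: "poly S \<zeta> = 0" unfolding S_def poly_xlaguerre_S[OF \<alpha>] using fin \<zeta> by (simp add: prod_zero_iff)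
  have "(poly S has_real_derivative q) (at \<zeta>)" unfolding q_def by (rule poly_DERIV)
  then have "(\<lambda>t. (poly S (\<zeta> + t) - poly S \<zeta>) / t) \<midarrow>0\<rightarrow> q" unfolding DERIV_def .
  \<comment> \<open>Multiplication by \<open>q\<close> makes the limit positive, which treats both
    signs of \<open>q\<close> together.\<close>
  then have "(\<lambda>t. poly S (\<zeta> + t) / t * q) \<midarrow>0\<rightarrow> q * q"
    unfolding S0 diff_zero by (intro tendsto_mult tendsto_const)
  moreover have "q * q / 2 < q * q" using q not_square_less_zero[of q] by (simp add: less_le)
  ultimately have "\<forall>\<^sub>F t in at 0. q * q / 2 < poly S (\<zeta> + t) / t * q" by (rule order_tendstoD)
  then obtain \<eta> where \<eta>: "0 < \<eta>" "\<And>t. t \<noteq> 0 \<Longrightarrow> \<bar>t\<bar> < \<eta> \<Longrightarrow> q * q / 2 < poly S (\<zeta> + t) / t * q"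
    unfolding eventually_at by (auto simp: dist_real_def)
  obtain B where B: "0 < B" "\<And>x. x \<in> {\<zeta> - 1..0} \<Longrightarrow> \<bar>poly (S + pderiv S) x\<bar> \<le> B"
  proof -
    have "bounded (poly (S + pderiv S) ` {\<zeta> - 1..0})"
      by (intro compact_imp_bounded compact_continuous_image) (auto intro!: continuous_intros)
    then show ?thesis using that by (auto simp: bounded_pos)
  qed
  define K where "K = 1 - \<zeta>"
  define c where "c = 1 / (1 + 2 * K + \<alpha>)"
  have c: "0 < c" using \<alpha> neg by (simp add: c_def K_def add_pos_pos)
  \<comment> \<open>At distance C / sqrt n from \<zeta>, the bounds |S| >= |q| C / (2 sqrt n) and W
    >= c sqrt n give |S W| >= B + 1, more than the bounded term S + S' can offset.\<close>
  define C where "C = 2 * (B + 1) / (c * \<bar>q\<bar>)"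
  have C: "0 < C" using B c q by (simp add: C_def)
  have "(\<lambda>n. C / sqrt (real n)) \<longlonglongrightarrow> 0" by real_asymp
  \<comment> \<open>The three bounds keep the test points in the range of the difference quotient
    estimate, in the interval where \<open>B\<close> is valid, and to the left of 0.\<close>
  moreover have "0 < min \<eta> (min 1 (- \<zeta>))" using \<eta> neg by simp
  ultimately have "\<forall>\<^sub>F n in sequentially. C / sqrt (real n) < min \<eta> (min 1 (- \<zeta>))" by (rule order_tendstoD)
  then have "\<forall>\<^sub>F n in sequentially. \<exists>z<0. poly (xlaguerre m \<alpha> n) z = 0 \<and> \<bar>z - \<zeta>\<bar> \<le> C / sqrt n"
    using eventually_ge_at_top[of 1]
  proof eventually_elim
    case (elim n)
    define u where "u = laguerre_points n (\<alpha> - 1)"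
    define \<epsilon> where "\<epsilon> = C / sqrt n"
    define f where "f = (\<lambda>x. poly (S + pderiv S) x + poly S x * (\<Sum>i\<in>{1..n}. 1 / (- x + u i)))"
    have \<epsilon>: "0 < \<epsilon>" "\<epsilon> < \<eta>" "\<epsilon> < 1" "\<epsilon> < - \<zeta>" using elim C by (auto simp: \<epsilon>_def)
    have upos: "0 < u i" if "i \<in> {1..n}" for i unfolding u_def by (rule laguerre_points_pos[OF a that])
    have y: "poly (xlaguerre m \<alpha> n) x = poly (laguerre n (\<alpha> - 1)) x * f x" if "x < 0" for x
    proof -
      have "poly (pderiv (laguerre n (\<alpha> - 1))) x = poly (laguerre n (\<alpha> - 1)) x * (\<Sum>i\<in>{1..n}. 1 / (x - u i))"
        unfolding laguerre_eq_prod[OF a] pderiv_smult poly_smult u_def[symmetric] poly_prod_linear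
        by (subst poly_pderiv_prod_linear) (use upos that in fastforce)+
      moreover have "(\<Sum>i\<in>{1..n}. 1 / (x - u i)) = - (\<Sum>i\<in>{1..n}. 1 / (- x + u i))"
        unfolding sum_negf[symmetric]
        by (intro sum.cong refl) (metis add.commute minus_diff_eq minus_divide_right uminus_add_conv_diff)
      ultimately show ?thesis by (simp add: poly_xlaguerre f_def S_def algebra_simps)
    qed
    \<comment> \<open>At distance \<epsilon> the bracket has the sign of q t, hence opposite signs
      on the two sides of \<zeta>; the Laguerre factor is positive on the negative axis.\<close>
    have f: "0 < f (\<zeta> + t) * q * t" if t: "\<bar>t\<bar> = \<epsilon>" for t
    proof -
      define W where "W = (\<Sum>i\<in>{1..n}. 1 / (- (\<zeta> + t) + u i))"
      define p where "p = poly (S + pderiv S) (\<zeta> + t)"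
      have t0: "t \<noteq> 0" using t \<epsilon> by auto
      have "0 < - (\<zeta> + t)" "- (\<zeta> + t) \<le> K" using t \<epsilon> by (auto simp: K_def abs_if split: if_splits)
      then have W: "c * sqrt n \<le> W"
        using laguerre_points_sum_lower[OF \<alpha>, of "- (\<zeta> + t)" K n] elim by (simp add: W_def u_def c_def)
      have "0 < c * sqrt n" using c elim by simp
      then have W0: "0 < W" using W by linarith
      have "q * q / 2 \<le> poly S (\<zeta> + t) / t * q" using \<eta>(2)[OF t0] t \<epsilon> by simp
      then have "q * q / 2 * (t * t) \<le> poly S (\<zeta> + t) / t * q * (t * t)" by (rule mult_right_mono) simp
      then have s1: "q * q / 2 * (t * t) \<le> poly S (\<zeta> + t) * q * t" using t0 by simp
      have tt: "t * t = \<epsilon> * \<epsilon>" using t by (metis abs_mult_self_eq)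
      have qq: "q * q = \<bar>q\<bar> * \<bar>q\<bar>" by simp
      have "\<epsilon> * (c * sqrt n) * \<bar>q\<bar> = 2 * (B + 1)" using c q elim by (simp add: \<epsilon>_def C_def field_simps)
      then have "(B + 1) * (\<bar>q\<bar> * \<epsilon>) = q * q / 2 * (t * t) * (c * sqrt n)" unfolding tt qq by algebra
      also have "\<dots> \<le> q * q / 2 * (t * t) * W" by (intro mult_left_mono W) auto
      also have "\<dots> \<le> poly S (\<zeta> + t) * q * t * W" using W0 by (intro mult_right_mono s1) auto
      finally have 1: "(B + 1) * (\<bar>q\<bar> * \<epsilon>) \<le> poly S (\<zeta> + t) * q * t * W" .
      have "\<bar>p\<bar> \<le> B" unfolding p_def using t \<epsilon> by (intro B) (auto simp: abs_if split: if_splits)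
      then have "\<bar>p\<bar> * (\<bar>q\<bar> * \<epsilon>) \<le> B * (\<bar>q\<bar> * \<epsilon>)" using \<epsilon> by (intro mult_right_mono) auto
      moreover have "- (p * q * t) \<le> \<bar>p\<bar> * (\<bar>q\<bar> * \<epsilon>)"
        using abs_ge_minus_self[of "p * q * t"] by (simp add: abs_mult t mult_ac)
      moreover have "0 < \<bar>q\<bar> * \<epsilon>" using q \<epsilon> by simp
      ultimately have "0 < p * q * t + poly S (\<zeta> + t) * q * t * W" using 1 by (simp add: algebra_simps)
      then show ?thesis unfolding f_def p_def W_def by (simp add: algebra_simps)
    qed
    have L: "0 < poly (laguerre n (\<alpha> - 1)) (\<zeta> - \<epsilon>)" "0 < poly (laguerre n (\<alpha> - 1)) (\<zeta> + \<epsilon>)"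
      using \<epsilon> neg by (auto intro!: poly_laguerre_pos_neg a)
    have "0 < f (\<zeta> + \<epsilon>) * q" "f (\<zeta> - \<epsilon>) * q < 0"
      using f[of \<epsilon>] f[of "- \<epsilon>"] \<epsilon> by (auto simp: zero_less_mult_iff mult_less_0_iff)
    then have "f (\<zeta> - \<epsilon>) * f (\<zeta> + \<epsilon>) < 0" by (auto simp: zero_less_mult_iff mult_less_0_iff)
    moreover have "poly (xlaguerre m \<alpha> n) (\<zeta> - \<epsilon>) * poly (xlaguerre m \<alpha> n) (\<zeta> + \<epsilon>) =
       (poly (laguerre n (\<alpha> - 1)) (\<zeta> - \<epsilon>) * poly (laguerre n (\<alpha> - 1)) (\<zeta> + \<epsilon>)) * (f (\<zeta> - \<epsilon>) * f (\<zeta> + \<epsilon>))"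
      using \<epsilon> neg by (simp add: y)
    ultimately have "poly (xlaguerre m \<alpha> n) (\<zeta> - \<epsilon>) * poly (xlaguerre m \<alpha> n) (\<zeta> + \<epsilon>) < 0"
      using mult_pos_neg[OF mult_pos_pos[OF L]] by simp
    then obtain z where "\<zeta> - \<epsilon> < z" "z < \<zeta> + \<epsilon>" "poly (xlaguerre m \<alpha> n) z = 0"
      using poly_IVT[of "\<zeta> - \<epsilon>" "\<zeta> + \<epsilon>"] \<epsilon> by auto
    then show ?case using \<epsilon> unfolding \<epsilon>_def[symmetric] by (intro exI[of _ z]) (auto simp: abs_if)
  qed
  then show ?thesis using C by blast
qed

text \<open>The zeros of \<open>S\<close> are distinct, so for large n the neighbourhoods of radius
  C / sqrt n are disjoint and the chosen nearby zeros differ. This yields m exceptional zeros, and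
  there are no more than m by the degree count, so the choice is onto.\<close>

lemma exceptional_zeros_matching:
  assumes \<alpha>: "0 < \<alpha>"
  shows "\<exists>C>0. \<forall>\<^sub>F n in sequentially. \<exists>f. bij_betw f (S_zeros m \<alpha>) (exceptional_zeros m \<alpha> n) \<and>
    (\<forall>y\<in>S_zeros m \<alpha>. \<bar>f y - y\<bar> \<le> C / sqrt n)"
proof -
  let ?Y = "S_zeros m \<alpha>"
  note fin = S_zeros(1)[OF \<alpha>, of m]
  have "\<forall>y\<in>?Y. \<exists>C>0. \<forall>\<^sub>F n in sequentially. \<exists>z<0. poly (xlaguerre m \<alpha> n) z = 0 \<and> \<bar>z - y\<bar> \<le> C / sqrt n"
    using xlaguerre_zero_near[OF \<alpha>] by blast
  from bchoice[OF this] obtain D where D: "\<forall>y\<in>?Y. 0 < D y \<and>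
      (\<forall>\<^sub>F n in sequentially. \<exists>z<0. poly (xlaguerre m \<alpha> n) z = 0 \<and> \<bar>z - y\<bar> \<le> D y / sqrt n)" ..
  define C where "C = 1 + (\<Sum>y\<in>?Y. D y)"
  have DC: "D y \<le> C" if "y \<in> ?Y" for y
    using member_le_sum[of y ?Y D] D fin that by (force simp: C_def less_imp_le)
  have C: "0 < C" unfolding C_def using D by (intro add_pos_nonneg sum_nonneg) (auto simp: less_imp_le)
  have "\<forall>\<^sub>F n in sequentially. \<forall>y\<in>?Y. \<exists>z<0. poly (xlaguerre m \<alpha> n) z = 0 \<and> \<bar>z - y\<bar> \<le> D y / sqrt n"
    using D by (intro eventually_ball_finite fin) blast
  moreover have "\<forall>\<^sub>F n in sequentially. \<forall>y\<in>?Y. \<forall>y'\<in>?Y - {y}. 2 * C / sqrt (real n) < \<bar>y - y'\<bar>"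
  proof (intro eventually_ball_finite fin finite_Diff ballI)
    fix y y' assume "y' \<in> ?Y - {y}"
    then have "0 < \<bar>y - y'\<bar>" by auto
    moreover have "(\<lambda>n. 2 * C / sqrt (real n)) \<longlonglongrightarrow> 0" by real_asymp
    ultimately show "\<forall>\<^sub>F n in sequentially. 2 * C / sqrt (real n) < \<bar>y - y'\<bar>" by (rule_tac order_tendstoD)
  qed
  ultimately have "\<forall>\<^sub>F n in sequentially. \<exists>f. bij_betw f ?Y (exceptional_zeros m \<alpha> n) \<and>
    (\<forall>y\<in>?Y. \<bar>f y - y\<bar> \<le> C / sqrt n)"
  proof eventually_elim
    case (elim n)
    from bchoice[OF elim(1)] obtain f where
      "\<forall>y\<in>?Y. f y < 0 \<and> poly (xlaguerre m \<alpha> n) (f y) = 0 \<and> \<bar>f y - y\<bar> \<le> D y / sqrt n" ..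
    then have f: "\<And>y. y \<in> ?Y \<Longrightarrow> f y \<in> exceptional_zeros m \<alpha> n" "\<And>y. y \<in> ?Y \<Longrightarrow> \<bar>f y - y\<bar> \<le> D y / sqrt n"
      by (auto simp: exceptional_zeros_def)
    have close: "\<bar>f y - y\<bar> \<le> C / sqrt n" if "y \<in> ?Y" for y
      using f(2)[OF that] divide_right_mono[OF DC[OF that], of "sqrt n"] by simp
    have inj: "inj_on f ?Y"
    proof (rule inj_onI, rule ccontr)
      fix y y' assume y: "y \<in> ?Y" "y' \<in> ?Y" "f y = f y'" "y \<noteq> y'"
      then have "2 * (C / sqrt n) < \<bar>y - y'\<bar>" using elim(2) by auto
      then show False using close[OF y(1)] close[OF y(2)] y(3) by linarith
    qed
    have "f ` ?Y = exceptional_zeros m \<alpha> n"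
    proof (rule card_seteq[OF exceptional_zeros_finite])
      show "f ` ?Y \<subseteq> exceptional_zeros m \<alpha> n" using f(1) by blast
      show "card (exceptional_zeros m \<alpha> n) \<le> card (f ` ?Y)"
        using card_exceptional_zeros_le[OF \<alpha>, of m n] card_image[OF inj] S_zeros(2)[OF \<alpha>, of m] by simp
    qed
    then show ?case using inj close by (intro exI[of _ f]) (auto simp: bij_betw_def)
  qed
  then show ?thesis using C by blast
qed

subsection \<open>The minimal energy\<close>

lemma weight_exceptional:
  assumes "0 < \<alpha>" shows "weight \<alpha> (exceptional_zeros m \<alpha> n) (S_zeros m \<alpha>)"
  using assms S_zeros(1,3)[OF assms] exceptional_zeros_finite exceptional_zeros_neg
  by unfold_locales auto

lemma xweight_eq:
  assumes "0 < \<alpha>"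
  shows "xweight m \<alpha> n x = wt \<alpha> (exceptional_zeros m \<alpha> n) (S_zeros m \<alpha>) x"
  by (simp add: xweight_def wt_def xlaguerre_P_def poly_xlaguerre_S[OF assms] power_divide)

definition max_log_energy :: "nat \<Rightarrow> real \<Rightarrow> nat \<Rightarrow> real" where
  "max_log_energy m \<alpha> n = ln (wvandermonde (xweight m \<alpha> n) {1..n} (SOME u. is_fekete (xweight m \<alpha> n) {1..n} u))"

lemma sum_pairs_sym:
  fixes f :: "nat \<Rightarrow> nat \<Rightarrow> real"
  assumes sym: "\<And>i j. f i j = f j i"
  shows "2 * (\<Sum>(i, j)\<in>{(i, j). 1 \<le> i \<and> i < j \<and> j \<le> n}. f i j) = (\<Sum>i\<in>{1..n}. \<Sum>j\<in>{1..n} - {i}. f i j)"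
proof -
  let ?P = "{(i, j). 1 \<le> i \<and> i < j \<and> j \<le> n}"
  let ?Q = "{(i, j). 1 \<le> j \<and> j < i \<and> i \<le> n}"
  have fin: "finite ?P" "finite ?Q" by (rule finite_subset[of _ "{1..n} \<times> {1..n}"]; auto)+
  have "(\<Sum>i\<in>{1..n}. \<Sum>j\<in>{1..n} - {i}. f i j) = (\<Sum>(i, j)\<in>Sigma {1..n} (\<lambda>i. {1..n} - {i}). f i j)"
    by (rule sum.Sigma) auto
  also have "Sigma {1..n} (\<lambda>i. {1..n} - {i}) = ?P \<union> ?Q" by auto
  also have "(\<Sum>(i, j)\<in>?P \<union> ?Q. f i j) = (\<Sum>(i, j)\<in>?P. f i j) + (\<Sum>(i, j)\<in>?Q. f i j)"
    using fin by (intro sum.union_disjoint) auto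
  also have "(\<Sum>(i, j)\<in>?Q. f i j) = (\<Sum>(i, j)\<in>?P. f i j)"
    by (rule sum.reindex_bij_witness[of _ "\<lambda>(i, j). (j, i)" "\<lambda>(i, j). (j, i)"]) (auto simp: sym)
  finally show ?thesis by simp
qed

text \<open>Passing to ordered pairs, each point carries its weight term 2 (n - 1) times, which
  removes the exponent 1 / (2 (n - 1)). A coincidence of two points makes one kernel value, and
  hence the sum, infinite.\<close>

lemma kernel_sum:
  assumes \<alpha>: "0 < \<alpha>" and c: "0 < c" and n: "2 \<le> n" and pos: "\<And>i. i \<in> {1..n} \<Longrightarrow> 0 < u i"
  shows "ereal (2 / (real n * (real n - 1))) * (\<Sum>(i, j)\<in>{(i, j). 1 \<le> i \<and> i < j \<and> j \<le> n}. kernel c m \<alpha> n (u i) (u j)) =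
    (if inj_on u {1..n} then ereal (ln n - ln c - ln (wvandermonde (xweight m \<alpha> n) {1..n} u) / (real n * (real n - 1))) else \<infinity>)"
proof -
  let ?P = "{(i, j). 1 \<le> i \<and> i < j \<and> j \<le> n}" and ?v = "xweight m \<alpha> n" and ?I = "{1..n}"
  have fin: "finite ?P" by (rule finite_subset[of _ "{1..n} \<times> {1..n}"]) auto
  have v: "0 < ?v (u i)" if "i \<in> ?I" for i
    unfolding xweight_eq[OF \<alpha>] by (rule weight.v_pos[OF weight_exceptional[OF \<alpha>] pos[OF that]])
  have n1: "0 < real n - 1" using n by simp
  define g where "g = (\<lambda>i. ln (?v (u i)) / (2 * (real n - 1)))"
  define f where "f = (\<lambda>i j. ln n - ln c - ln \<bar>u i - u j\<bar> - (g i + g j))"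
  have ker: "kernel c m \<alpha> n (u i) (u j) = (if u i = u j then \<infinity> else ereal (f i j))" if "i \<in> ?I" "j \<in> ?I" for i j
  proof -
    define x where "x = c / real n * \<bar>u i - u j\<bar>"
    define p where "p = ?v (u i) powr (1 / (2 * (real n - 1)))"
    define q where "q = ?v (u j) powr (1 / (2 * (real n - 1)))"
    have pq: "0 < p" "0 < q" "ln p = g i" "ln q = g j"
      using v[OF that(1)] v[OF that(2)] by (auto simp: p_def q_def g_def)
    show ?thesis
    proof (cases "u i = u j")
      case True
      then show ?thesis by (simp add: kernel_def elog_def)
    next
      case False
      then have x: "0 < x" using c n by (simp add: x_def)
      have lx: "ln x = ln c - ln n + ln \<bar>u i - u j\<bar>" using False c n by (simp add: x_def ln_mult_pos ln_div)
      have "ln (x * p * q) = ln x + g i + g j" using x pq by (simp add: ln_mult_pos)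
      moreover have "0 < x * p * q" using x pq by simp
      ultimately show ?thesis
        using False unfolding kernel_def elog_def x_def[symmetric] p_def[symmetric] q_def[symmetric] by (simp add: f_def lx)
    qed
  qed
  show ?thesis
  proof (cases "inj_on u ?I")
    case True
    have ne: "u i \<noteq> u j" if "i \<in> ?I" "j \<in> ?I" "i \<noteq> j" for i j using inj_onD[OF True] that by blast
    have "(\<Sum>(i, j)\<in>?P. kernel c m \<alpha> n (u i) (u j)) = (\<Sum>(i, j)\<in>?P. ereal (f i j))"
      by (intro sum.cong refl) (auto simp: ker ne)
    also have "\<dots> = ereal (\<Sum>(i, j)\<in>?P. f i j)" by (simp add: case_prod_unfold)
    also have "(\<Sum>(i, j)\<in>?P. f i j) = (\<Sum>i\<in>?I. \<Sum>j\<in>?I - {i}. f i j) / 2"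
      using sum_pairs_sym[of f n] by (simp add: f_def abs_minus_commute add.commute)
    also have "(\<Sum>i\<in>?I. \<Sum>j\<in>?I - {i}. f i j) = real n * (real n - 1) * (ln n - ln c) - ln (wvandermonde ?v ?I u)"
    proof -
      have card: "real (card (?I - {i})) = real n - 1" if "i \<in> ?I" for i
        using that n by (simp add: card_Diff_singleton of_nat_diff)
      have 1: "(\<Sum>i\<in>?I. \<Sum>j\<in>?I - {i}. ln \<bar>u i - u j\<bar>) = ln (vandermonde ?I u)"
      proof -
        have "(\<Sum>j\<in>?I - {i}. ln \<bar>u i - u j\<bar>) = ln (\<Prod>j\<in>?I - {i}. \<bar>u i - u j\<bar>)" if "i \<in> ?I" for i
          by (rule ln_prod[symmetric]) (use ne that in auto)
        then show ?thesis unfolding vandermonde_def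
          by (subst ln_prod) (use ne in \<open>auto simp: prod_zero_iff\<close>)
      qed
      have "(\<Sum>i\<in>?I. \<Sum>j\<in>?I - {i}. g i) = (\<Sum>i\<in>?I. (real n - 1) * g i)"
        by (intro sum.cong refl) (simp add: card)
      also have "\<dots> = (\<Sum>i\<in>?I. ln (?v (u i)) / 2)"
      proof (intro sum.cong refl)
        have "k * (l / (2 * k)) = l / 2" if "0 < k" for k l :: real using that by simp
        then show "(real n - 1) * g i = ln (?v (u i)) / 2" for i unfolding g_def using n1 by blast
      qed
      also have "\<dots> = ln (\<Prod>i\<in>?I. ?v (u i)) / 2"
        by (subst ln_prod) (use v in \<open>force simp: sum_divide_distrib\<close>)+
      finally have 2: "(\<Sum>i\<in>?I. \<Sum>j\<in>?I - {i}. g i) = ln (\<Prod>i\<in>?I. ?v (u i)) / 2" .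
      have 3: "(\<Sum>i\<in>?I. \<Sum>j\<in>?I - {i}. g j) = (\<Sum>i\<in>?I. \<Sum>j\<in>?I - {i}. g i)"
        by (rule sum_offdiag_swap) simp
      have 4: "(\<Sum>i\<in>?I. \<Sum>j\<in>?I - {i}. ln n - ln c) = real n * (real n - 1) * (ln n - ln c)"
      proof -
        have "(\<Sum>i\<in>?I. \<Sum>j\<in>?I - {i}. ln n - ln c) = (\<Sum>i\<in>?I. (real n - 1) * (ln n - ln c))"
          by (intro sum.cong refl) (simp add: card)
        then show ?thesis by simp
      qed
      have "ln (wvandermonde ?v ?I u) = ln (vandermonde ?I u) + ln (\<Prod>i\<in>?I. ?v (u i))"
        unfolding wvandermonde_def using vandermonde_pos[OF True] v by (intro ln_mult_pos prod_pos) auto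
      then show ?thesis unfolding f_def sum_subtractf sum.distrib 1 2 3 4 by (simp add: algebra_simps)
    qed
    finally show ?thesis using True n by (simp add: field_simps)
  next
    case False
    then obtain i j where ij: "i \<in> ?I" "j \<in> ?I" "i < j" "u i = u j"
      unfolding inj_on_def by (metis linorder_neqE_nat)
    have "(\<Sum>(i, j)\<in>?P. kernel c m \<alpha> n (u i) (u j)) = \<infinity>"
    proof (subst sum_Pinfty, intro conjI bexI[of _ "(i, j)"] fin)
      show "(case (i, j) of (i, j) \<Rightarrow> kernel c m \<alpha> n (u i) (u j)) = \<infinity>" using ij by (simp add: ker)
    qed (use ij in auto)
    then show ?thesis using False n by simp
  qed
qed

text \<open>Configurations with coincidences have infinite energy and do not affect the infimum; on
  the others the energy decreases as \<open>wvandermonde\<close> grows, so the infimum is attained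
  at Fekete points.\<close>

lemma min_energy_eq:
  assumes \<alpha>: "0 < \<alpha>" and c: "0 < c" and n: "2 \<le> n"
  shows "min_energy c m \<alpha> n = ereal (ln n - ln c - max_log_energy m \<alpha> n / (real n * (real n - 1)))"
proof -
  let ?v = "xweight m \<alpha> n"
  define u where "u = (SOME u. is_fekete ?v {1..n} u)"
  have veq: "?v = wt \<alpha> (exceptional_zeros m \<alpha> n) (S_zeros m \<alpha>)" by (rule ext) (rule xweight_eq[OF \<alpha>])
  have u: "is_fekete ?v {1..n} u"
  proof -
    have "\<exists>u. is_fekete ?v {1..n} u"
      unfolding veq by (rule weight.fekete_exists[OF weight_exceptional[OF \<alpha>]]) simp
    then show ?thesis unfolding u_def by (rule someI_ex)
  qed
  have nn: "0 < real n * (real n - 1)" using n by simp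
  have E: "max_log_energy m \<alpha> n = ln (wvandermonde ?v {1..n} u)" by (simp add: max_log_energy_def u_def)
  show ?thesis unfolding min_energy_def
  proof (rule antisym)
    show "(INF u\<in>{u. \<forall>i\<in>{1..n}. 0 < u i}. ereal (2 / (real n * (real n - 1))) *
        (\<Sum>(i, j)\<in>{(i, j). 1 \<le> i \<and> i < j \<and> j \<le> n}. kernel c m \<alpha> n (u i) (u j)))
        \<le> ereal (ln n - ln c - max_log_energy m \<alpha> n / (real n * (real n - 1)))"
    proof (rule INF_lower2)
      have upos: "\<And>i. i \<in> {1..n} \<Longrightarrow> 0 < u i" and inj: "inj_on u {1..n}" using u by (auto simp: is_fekete_def)
      show "u \<in> {u. \<forall>i\<in>{1..n}. 0 < u i}" using upos by blast
      show "ereal (2 / (real n * (real n - 1))) *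
        (\<Sum>(i, j)\<in>{(i, j). 1 \<le> i \<and> i < j \<and> j \<le> n}. kernel c m \<alpha> n (u i) (u j))
        \<le> ereal (ln n - ln c - max_log_energy m \<alpha> n / (real n * (real n - 1)))"
        using kernel_sum[OF \<alpha> c n upos, where m = m] inj unfolding E by (simp only: if_True order_refl)
    qed
    show "ereal (ln n - ln c - max_log_energy m \<alpha> n / (real n * (real n - 1))) \<le>
        (INF u\<in>{u. \<forall>i\<in>{1..n}. 0 < u i}. ereal (2 / (real n * (real n - 1))) *
        (\<Sum>(i, j)\<in>{(i, j). 1 \<le> i \<and> i < j \<and> j \<le> n}. kernel c m \<alpha> n (u i) (u j)))"
    proof (rule INF_greatest)
      fix w :: "nat \<Rightarrow> real" assume "w \<in> {u. \<forall>i\<in>{1..n}. 0 < u i}"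
      then have w: "\<And>i. i \<in> {1..n} \<Longrightarrow> 0 < w i" by blast
      have "ln (wvandermonde ?v {1..n} w) / (real n * (real n - 1)) \<le> max_log_energy m \<alpha> n / (real n * (real n - 1))"
        if "inj_on w {1..n}"
      proof -
        have "0 < wvandermonde ?v {1..n} w"
          unfolding veq by (rule weight.wvandermonde_pos[OF weight_exceptional[OF \<alpha>] _ w that]) auto
        moreover have "wvandermonde ?v {1..n} w \<le> wvandermonde ?v {1..n} u"
          using u w by (simp add: is_fekete_def)
        ultimately show ?thesis using nn unfolding E by (intro divide_right_mono) auto
      qed
      then show "ereal (ln n - ln c - max_log_energy m \<alpha> n / (real n * (real n - 1))) \<le>
         ereal (2 / (real n * (real n - 1))) *
        (\<Sum>(i, j)\<in>{(i, j). 1 \<le> i \<and> i < j \<and> j \<le> n}. kernel c m \<alpha> n (w i) (w j))"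
        using kernel_sum[OF \<alpha> c n w, where m = m] by (cases "inj_on w {1..n}") (simp_all only: if_True if_False ereal_less_eq, simp_all)
    qed
  qed
qed

text \<open>Pair the factors through \<open>f\<close>. From ln t <= t - 1 each quotient p / q
  satisfies ln (p / q) <= |p - q| / q, with both p and q at least \<beta> + x; exchanging p and q
  gives the other sign.\<close>

lemma abs_ln_prod_ratio_le:
  fixes f :: "real \<Rightarrow> real" and \<epsilon> \<beta> x :: real
  assumes bij: "bij_betw f Y Z" and fin: "finite Y"
    and Y: "\<And>y. y \<in> Y \<Longrightarrow> y \<le> - \<beta>" "\<And>y. y \<in> Y \<Longrightarrow> f y \<le> - \<beta>"
    and close: "\<And>y. y \<in> Y \<Longrightarrow> \<bar>f y - y\<bar> \<le> \<epsilon>" and \<beta>: "0 < \<beta>" and x: "0 < x"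
  shows "\<bar>ln ((\<Prod>z\<in>Z. x - z) / (\<Prod>y\<in>Y. x - y))\<bar> \<le> card Y * \<epsilon> / (\<beta> + x)"
proof -
  have *: "ln (p / q) \<le> \<epsilon> / (\<beta> + x)" if "\<bar>p - q\<bar> \<le> \<epsilon>" "\<beta> + x \<le> p" "\<beta> + x \<le> q" for p q
  proof -
    have q: "0 < q" "0 < p" "0 < \<beta> + x" using that \<beta> x by linarith+
    have "ln (p / q) \<le> p / q - 1" using q by (intro ln_le_minus_one) auto
    also have "\<dots> = (p - q) / q" using q by (simp add: field_simps)
    also have "\<dots> \<le> \<epsilon> / (\<beta> + x)" using that q by (intro frac_le) auto
    finally show ?thesis .
  qed
  have pos: "\<beta> + x \<le> x - f y" "\<beta> + x \<le> x - y" if "y \<in> Y" for y using Y[OF that] by auto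
  have "(\<Prod>z\<in>Z. x - z) / (\<Prod>y\<in>Y. x - y) = (\<Prod>y\<in>Y. (x - f y) / (x - y))"
    using prod.reindex_bij_betw[OF bij, of "\<lambda>z. x - z"] by (simp add: prod_dividef)
  then have "ln ((\<Prod>z\<in>Z. x - z) / (\<Prod>y\<in>Y. x - y)) = (\<Sum>y\<in>Y. ln ((x - f y) / (x - y)))"
    using pos \<beta> x by (simp only:) (intro ln_prod fin, force)
  also have "\<bar>\<dots>\<bar> \<le> (\<Sum>y\<in>Y. \<epsilon> / (\<beta> + x))"
  proof (rule order_trans[OF sum_abs], rule sum_mono)
    fix y assume y: "y \<in> Y"
    have p: "0 < x - f y" "0 < x - y" using pos[OF y] \<beta> x by linarith+
    have "ln ((x - f y) / (x - y)) \<le> \<epsilon> / (\<beta> + x)" "ln ((x - y) / (x - f y)) \<le> \<epsilon> / (\<beta> + x)"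
      using close[OF y] pos[OF y] by (intro *; simp)+
    moreover have "ln ((x - y) / (x - f y)) = - ln ((x - f y) / (x - y))" using p by (simp add: ln_div)
    ultimately show "\<bar>ln ((x - f y) / (x - y))\<bar> \<le> \<epsilon> / (\<beta> + x)" by linarith
  qed
  finally show ?thesis by simp
qed

text \<open>Each maximizer is inserted into the other maximization problem. The energies then differ
  at most by the sum of ln \<rho> over one of the two configurations, where \<rho> is the quotient
  of the weights. That sum is at most 2 m (D / sqrt n) times \<Sum> 1 / (\<beta> + w_i), and the
  second factor is at most K sqrt n at both maximizers.\<close>

lemma max_log_energy_near_laguerre:
  assumes \<alpha>: "0 < \<alpha>"
  shows "\<exists>C. \<forall>\<^sub>F n in sequentially. \<bar>max_log_energy m \<alpha> n - laguerre_energy n \<alpha>\<bar> \<le> C"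
proof -
  let ?Y = "S_zeros m \<alpha>"
  have a: "-1 < \<alpha>" using \<alpha> by simp
  obtain D where D: "0 < D" and match: "\<forall>\<^sub>F n in sequentially. \<exists>f. bij_betw f ?Y (exceptional_zeros m \<alpha> n) \<and>
    (\<forall>y\<in>?Y. \<bar>f y - y\<bar> \<le> D / sqrt n)" using exceptional_zeros_matching[OF \<alpha>] by blast
  note fin = S_zeros(1)[OF \<alpha>, of m]
  \<comment> \<open>Zeros of \<open>S\<close> lie at or below -2 \<beta>, so exceptional zeros
    within \<beta> of them stay at or below -\<beta>. The element -1 makes the maximum range over a
    nonempty set.\<close>
  define \<beta> where "\<beta> = - Max (insert (- 1) ?Y) / 2"
  have "Max (insert (- 1) ?Y) \<in> insert (- 1) ?Y" using fin by (intro Max_in) auto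
  then have \<beta>: "0 < \<beta>" using S_zeros(3)[OF \<alpha>, of _ m] by (auto simp: \<beta>_def)
  have Y\<beta>: "y \<le> - 2 * \<beta>" if "y \<in> ?Y" for y
  proof -
    have "y \<le> Max (insert (- 1) ?Y)" using fin that by (intro Max_ge) auto
    then show ?thesis unfolding \<beta>_def by simp
  qed
  \<comment> \<open>Bounds the deviation of \<open>dlog_wt\<close> from the classical value: twice
    the difference of two sums of m terms, each between 0 and 1 / \<beta>.\<close>
  define C0 where "C0 = 2 * real m / \<beta>"
  define K where "K = 2 / \<beta> + sqrt (2 * (C0 + (1 + C0)) / \<beta>)"
  have C0: "0 \<le> C0" using \<beta> by (simp add: C0_def)
  have K: "(\<Sum>i\<in>{1..n}. 1 / (\<beta> + u i)) \<le> K * sqrt n"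
    if st: "stationary {1..n} u h" and n: "1 \<le> n"
      and h: "\<And>x. 0 < x \<Longrightarrow> \<bar>h x - ((\<alpha> + 1) / x - 1)\<bar> \<le> C0" for u h n
  proof -
    have "(\<Sum>i\<in>{1..n}. 1 / (\<beta> + u i)) \<le> 2 / \<beta> + sqrt (2 * (C0 + (1 + C0)) / \<beta>) * sqrt (card {1..n})"
    proof (rule stationary.sum_inverse_upper[OF st])
      show "h x \<le> (\<alpha> + 1) / x + C0" "(\<alpha> + 1) / x - (1 + C0) \<le> h x" if "0 < x" for x
        using h[OF that] by linarith+
    qed (use \<alpha> \<beta> C0 in auto)
    also have "\<dots> \<le> K * sqrt n"
    proof -
      have "2 / \<beta> * 1 \<le> 2 / \<beta> * sqrt n" using \<beta> n by (intro mult_left_mono) auto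
      then show ?thesis by (simp add: K_def algebra_simps)
    qed
    finally show ?thesis .
  qed
  have "(\<lambda>n. D / sqrt (real n)) \<longlonglongrightarrow> 0" by real_asymp
  then have "\<forall>\<^sub>F n in sequentially. D / sqrt (real n) < \<beta>" using \<beta> by (rule order_tendstoD)
  with match eventually_ge_at_top[of 1] have "\<forall>\<^sub>F n in sequentially. \<bar>max_log_energy m \<alpha> n - laguerre_energy n \<alpha>\<bar> \<le> 2 * m * D * K"
  proof eventually_elim
    case (elim n)
    let ?Z = "exceptional_zeros m \<alpha> n" and ?v = "xweight m \<alpha> n" and ?I = "{1..n}"
    obtain f where bij: "bij_betw f ?Y ?Z" and close: "\<And>y. y \<in> ?Y \<Longrightarrow> \<bar>f y - y\<bar> \<le> D / sqrt n" using elim by blast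
    have f\<beta>: "f y \<le> - \<beta>" "y \<le> - \<beta>" if "y \<in> ?Y" for y using close[OF that] Y\<beta>[OF that] elim \<beta> by linarith+
    have Z\<beta>: "z \<le> - \<beta>" if "z \<in> ?Z" for z
    proof -
      have "z \<in> f ` ?Y" using that bij_betw_imp_surj_on[OF bij] by simp
      then show ?thesis by (rule imageE) (simp add: f\<beta>(1))
    qed
    have cards: "card ?Y = m" "card ?Z = m" using S_zeros(2)[OF \<alpha>, of m] bij_betw_same_card[OF bij] by auto
    have veq: "?v = wt \<alpha> ?Z ?Y" by (rule ext) (rule xweight_eq[OF \<alpha>])
    interpret weight \<alpha> ?Z ?Y by (rule weight_exceptional[OF \<alpha>])
    define u where "u = (SOME u. is_fekete ?v ?I u)"
    define t where "t = laguerre_points n \<alpha>"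
    define \<rho> where "\<rho> = (\<lambda>x. ((\<Prod>z\<in>?Z. x - z) / (\<Prod>y\<in>?Y. x - y))\<^sup>2)"
    have u: "is_fekete ?v ?I u"
    proof -
      have "\<exists>u. is_fekete ?v ?I u" unfolding veq by (rule fekete_exists) simp
      then show ?thesis unfolding u_def by (rule someI_ex)
    qed
    have t: "is_fekete (wt \<alpha> {} {}) ?I t" unfolding t_def by (rule is_fekete_laguerre_points[OF a])
    have pos: "0 < u i" "0 < t i" if "i \<in> ?I" for i using u t that by (auto simp: is_fekete_def)
    have \<rho>pos: "0 < \<rho> x" if "0 < x" for x using prod_Z_pos[of x] prod_Y_pos[of x] that by (simp add: \<rho>_def)
    have factor: "wvandermonde ?v ?I w = wvandermonde (wt \<alpha> {} {}) ?I w * (\<Prod>i\<in>?I. \<rho> (w i))" for w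
      by (simp add: veq wvandermonde_def wt_def \<rho>_def prod.distrib)
    have bound: "\<bar>\<Sum>i\<in>?I. ln (\<rho> (w i))\<bar> \<le> 2 * m * D * K"
      if w: "\<And>i. i \<in> ?I \<Longrightarrow> 0 < w i" and W: "(\<Sum>i\<in>?I. 1 / (\<beta> + w i)) \<le> K * sqrt n" for w
    proof -
      have "\<bar>\<Sum>i\<in>?I. ln (\<rho> (w i))\<bar> \<le> (\<Sum>i\<in>?I. \<bar>ln (\<rho> (w i))\<bar>)" by (rule sum_abs)
      also have "\<dots> \<le> (\<Sum>i\<in>?I. 2 * m * (D / sqrt n) * (1 / (\<beta> + w i)))"
      proof (rule sum_mono)
        fix i assume i: "i \<in> ?I"
        have "\<bar>ln ((\<Prod>z\<in>?Z. w i - z) / (\<Prod>y\<in>?Y. w i - y))\<bar> \<le> card ?Y * (D / sqrt n) / (\<beta> + w i)"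
          by (rule abs_ln_prod_ratio_le[OF bij fin f\<beta>(2) f\<beta>(1) close \<beta> w[OF i]])
        moreover have "ln (\<rho> (w i)) = 2 * ln ((\<Prod>z\<in>?Z. w i - z) / (\<Prod>y\<in>?Y. w i - y))"
          using prod_Z_pos[of "w i"] prod_Y_pos[of "w i"] w[OF i] unfolding \<rho>_def by (subst ln_realpow) auto
        ultimately show "\<bar>ln (\<rho> (w i))\<bar> \<le> 2 * m * (D / sqrt n) * (1 / (\<beta> + w i))"
          by (simp add: cards abs_mult)
      qed
      also have "\<dots> = 2 * m * (D / sqrt n) * (\<Sum>i\<in>?I. 1 / (\<beta> + w i))" by (rule sum_distrib_left[symmetric])
      also have "\<dots> \<le> 2 * m * (D / sqrt n) * (K * sqrt n)" using D by (intro mult_left_mono W) auto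
      also have "\<dots> = 2 * m * D * K" using elim by simp
      finally show ?thesis .
    qed
    have sum_bound: "(\<Sum>z\<in>A. 1 / (x - z)) \<in> {0..m / \<beta>}" if "card A = m" "\<And>z. z \<in> A \<Longrightarrow> z \<le> - \<beta>" "0 < x" for A x
    proof -
      have "0 \<le> 1 / (x - z) \<and> 1 / (x - z) \<le> 1 / \<beta>" if "z \<in> A" for z
        using \<open>z \<in> A \<Longrightarrow> z \<le> - \<beta>\<close>[OF that] \<open>0 < x\<close> \<beta> by (auto intro!: frac_le)
      then have "0 \<le> (\<Sum>z\<in>A. 1 / (x - z))" "(\<Sum>z\<in>A. 1 / (x - z)) \<le> (\<Sum>z\<in>A. 1 / \<beta>)"
        by (intro sum_nonneg sum_mono; blast)+
      then show ?thesis using that by simp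
    qed
    have "stationary ?I u (dlog_wt \<alpha> ?Z ?Y)"
      using u unfolding veq by (intro fekete_stationary) auto
    then have Wu: "(\<Sum>i\<in>?I. 1 / (\<beta> + u i)) \<le> K * sqrt n"
    proof (rule K)
      fix x :: real assume "0 < x"
      then show "\<bar>dlog_wt \<alpha> ?Z ?Y x - ((\<alpha> + 1) / x - 1)\<bar> \<le> C0"
        using sum_bound[of ?Z x] sum_bound[of ?Y x] cards Z\<beta> f\<beta>(2) by (simp add: dlog_wt_def C0_def abs_le_iff)
    qed (use elim in simp)
    have Wt: "(\<Sum>i\<in>?I. 1 / (\<beta> + t i)) \<le> K * sqrt n"
      using stationary_laguerre_points[OF a] unfolding t_def by (rule K) (use elim C0 in auto)
    have prod\<rho>: "ln (\<Prod>i\<in>?I. \<rho> (w i)) = (\<Sum>i\<in>?I. ln (\<rho> (w i)))" "0 < (\<Prod>i\<in>?I. \<rho> (w i))" if "\<And>i. i \<in> ?I \<Longrightarrow> 0 < w i" for w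
    proof -
      have "\<rho> (w i) \<noteq> 0" if "i \<in> ?I" for i using \<rho>pos[OF \<open>i \<in> ?I \<Longrightarrow> 0 < w i\<close>[OF that]] by simp
      then show "ln (\<Prod>i\<in>?I. \<rho> (w i)) = (\<Sum>i\<in>?I. ln (\<rho> (w i)))" by (intro ln_prod) auto
      show "0 < (\<Prod>i\<in>?I. \<rho> (w i))" using \<rho>pos that by (intro prod_pos) blast
    qed
    have Fpos: "0 < wvandermonde (wt \<alpha> {} {}) ?I w" if "is_fekete g ?I w" for g w
      using that by (intro weight.wvandermonde_pos[OF weight_classical[OF a]]) (auto simp: is_fekete_def)
    have lnF: "ln (wvandermonde ?v ?I w) = ln (wvandermonde (wt \<alpha> {} {}) ?I w) + (\<Sum>i\<in>?I. ln (\<rho> (w i)))"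
      if "is_fekete g ?I w" for g w
    proof -
      have w: "\<And>i. i \<in> ?I \<Longrightarrow> 0 < w i" using that by (simp add: is_fekete_def)
      show ?thesis
        unfolding factor using ln_mult_pos[OF Fpos[OF that] prod\<rho>(2)[of w]] prod\<rho>(1)[of w] w by simp
    qed
    have E: "max_log_energy m \<alpha> n = ln (wvandermonde ?v ?I u)" "laguerre_energy n \<alpha> = ln (wvandermonde (wt \<alpha> {} {}) ?I t)"
      by (simp_all add: max_log_energy_def u_def laguerre_energy_def t_def)
    have "wvandermonde ?v ?I t \<le> wvandermonde ?v ?I u" using u pos by (simp add: is_fekete_def)
    moreover have "0 < wvandermonde ?v ?I t" unfolding factor using Fpos[OF t] prod\<rho>(2)[of t] pos by simp
    ultimately have 1: "ln (wvandermonde ?v ?I t) \<le> max_log_energy m \<alpha> n" unfolding E by simp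
    have "wvandermonde (wt \<alpha> {} {}) ?I u \<le> wvandermonde (wt \<alpha> {} {}) ?I t" using t pos by (simp add: is_fekete_def)
    then have 2: "ln (wvandermonde (wt \<alpha> {} {}) ?I u) \<le> laguerre_energy n \<alpha>" unfolding E using Fpos[OF u] by simp
    show ?case using 1 2 lnF[OF u] lnF[OF t] bound[OF pos(1) Wu] bound[OF pos(2) Wt] unfolding E by linarith
  qed
  then show ?thesis by blast
qed

subsection \<open>Asymptotics\<close>

text \<open>Telescoping from a fixed index: fewer than n increments, each at most K ln n by
  monotonicity of the logarithm; the constant starting value is absorbed.\<close>

lemma bigo_of_increments:
  fixes h :: "nat \<Rightarrow> real"
  assumes "(\<lambda>n. h n - h (n - 1)) \<in> O(\<lambda>n. ln (real n))"
  shows "h \<in> O(\<lambda>n. real n * ln (real n))"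
proof -
  obtain K where "0 < K" and "\<forall>\<^sub>F n in sequentially. norm (h n - h (n - 1)) \<le> K * norm (ln (real n))"
    using landau_o.bigE[OF assms] by blast
  then obtain N where N: "\<And>n. N \<le> n \<Longrightarrow> \<bar>h n - h (n - 1)\<bar> \<le> K * \<bar>ln (real n)\<bar>"
    by (auto simp: eventually_sequentially)
  have bound: "\<bar>h n\<bar> \<le> \<bar>h (Suc N)\<bar> + K * (real n * ln (real n))" if "Suc N \<le> n" for n
    using that
  proof (induction n rule: dec_induct)
    case base
    then show ?case using \<open>0 < K\<close> by simp
  next
    case (step n)
    have "\<bar>h (Suc n)\<bar> \<le> \<bar>h n\<bar> + K * ln (real (Suc n))"
    proof -
      have "\<bar>h (Suc n) - h n\<bar> \<le> K * ln (real (Suc n))" using N[of "Suc n"] step.hyps by simp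
      then show ?thesis by linarith
    qed
    also have "\<dots> \<le> \<bar>h (Suc N)\<bar> + K * (real n * ln (real n)) + K * ln (real (Suc n))" using step.IH by simp
    also have "K * (real n * ln (real n)) \<le> K * (real n * ln (real (Suc n)))"
      using \<open>0 < K\<close> step.hyps by (intro mult_left_mono) auto
    finally show ?case by (simp add: algebra_simps)
  qed
  have "h \<in> O(\<lambda>n. \<bar>h (Suc N)\<bar> + K * (real n * ln (real n)))"
  proof (rule bigoI[of _ 1])
    show "\<forall>\<^sub>F n in sequentially. norm (h n) \<le> 1 * norm (\<bar>h (Suc N)\<bar> + K * (real n * ln (real n)))"
      using eventually_ge_at_top[of "Suc N"] by eventually_elim (use bound in force)
  qed
  also have "(\<lambda>n. \<bar>h (Suc N)\<bar> + K * (real n * ln (real n))) \<in> O(\<lambda>n. real n * ln (real n))"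
  proof (rule sum_in_bigo)
    show "(\<lambda>n. \<bar>h (Suc N)\<bar>) \<in> O(\<lambda>n. real n * ln (real n))" by real_asymp
  qed simp
  finally show ?thesis .
qed

lemma bigo_pred:
  fixes h g :: "nat \<Rightarrow> real"
  assumes "h \<in> O(g)" shows "(\<lambda>n. h (n - 1)) \<in> O(\<lambda>n. g (n - 1))"
proof -
  have "filterlim (\<lambda>n::nat. n - 1) at_top at_top"
    by (subst filterlim_sequentially_Suc[symmetric]) (simp add: filterlim_ident)
  from landau_o.big.compose[OF assms this] show ?thesis .
qed

text \<open>The main term x^2 ln x - 3/2 x^2 has derivative 2 x ln x - 2 x, the main term of the
  increment, and its second derivative is 2 ln x. Its own increments therefore agree with those of
  the energy up to O(ln n), and telescoping gives the second part.\<close>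

lemma laguerre_energy_asymptotics:
  assumes "0 < \<alpha>"
  shows "(\<lambda>n. laguerre_energy n \<alpha> - laguerre_energy (n - 1) \<alpha> - (2 * real n * ln (real n) - 2 * real n)) \<in> O(\<lambda>n. ln (real n))"
    and "(\<lambda>n. laguerre_energy n \<alpha> - ((real n)\<^sup>2 * ln (real n) - 3 / 2 * (real n)\<^sup>2)) \<in> O(\<lambda>n. real n * ln (real n))"
proof -
  let ?e = "\<lambda>n. laguerre_energy n \<alpha>" and ?g = "\<lambda>n. (real n)\<^sup>2 * ln (real n) - 3 / 2 * (real n)\<^sup>2"
  have "\<forall>\<^sub>F n in sequentially. real n * ln (real n) + (real n + \<alpha>) * ln (real n + \<alpha>) - 2 * real n + 1 - \<alpha> - (2 * real n * ln (real n) - 2 * real n)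
     = ?e n - ?e (n - 1) - (2 * real n * ln (real n) - 2 * real n)"
    using eventually_ge_at_top[of 2]
  proof eventually_elim
    case (elim n)
    then show ?case using laguerre_energy_diff[of \<alpha> n] assms by simp
  qed
  moreover have "(\<lambda>n. real n * ln (real n) + (real n + \<alpha>) * ln (real n + \<alpha>) - 2 * real n + 1 - \<alpha> - (2 * real n * ln (real n) - 2 * real n))
     \<in> O(\<lambda>n. ln (real n))"
    using assms by real_asymp
  ultimately show 1: "(\<lambda>n. ?e n - ?e (n - 1) - (2 * real n * ln (real n) - 2 * real n)) \<in> O(\<lambda>n. ln (real n))"
    by (rule landau_o.big.in_cong[THEN iffD1])
  have "(\<lambda>n. 2 * real n * ln (real n) - 2 * real n - (?g n - ((real n - 1)\<^sup>2 * ln (real n - 1) - 3 / 2 * (real n - 1)\<^sup>2))) \<in> O(\<lambda>n. ln (real n))"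
    by real_asymp
  note sum_in_bigo(1)[OF 1 this]
  also have "(\<lambda>n. ?e n - ?e (n - 1) - (2 * real n * ln (real n) - 2 * real n) +
      (2 * real n * ln (real n) - 2 * real n - (?g n - ((real n - 1)\<^sup>2 * ln (real n - 1) - 3 / 2 * (real n - 1)\<^sup>2)))) =
      (\<lambda>n. ?e n - ?e (n - 1) - (?g n - ((real n - 1)\<^sup>2 * ln (real n - 1) - 3 / 2 * (real n - 1)\<^sup>2)))"
    by (rule ext) linarith
  finally have 2: "(\<lambda>n. ?e n - ?e (n - 1) - (?g n - ((real n - 1)\<^sup>2 * ln (real n - 1) - 3 / 2 * (real n - 1)\<^sup>2))) \<in> O(\<lambda>n. ln (real n))" .
  have "\<forall>\<^sub>F n in sequentially. ?e n - ?e (n - 1) - (?g n - ((real n - 1)\<^sup>2 * ln (real n - 1) - 3 / 2 * (real n - 1)\<^sup>2))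
     = (?e n - ?g n) - (?e (n - 1) - ?g (n - 1))"
    using eventually_ge_at_top[of 1] by eventually_elim (simp add: of_nat_diff)
  from this 2 have "(\<lambda>n. (?e n - ?g n) - (?e (n - 1) - ?g (n - 1))) \<in> O(\<lambda>n. ln (real n))"
    by (rule landau_o.big.in_cong[THEN iffD1])
  then show "(\<lambda>n. ?e n - ?g n) \<in> O(\<lambda>n. real n * ln (real n))" by (rule bigo_of_increments)
qed

theorem theorem4:
  fixes m :: nat and \<alpha> c :: real
  assumes "m \<ge> 1" and "\<alpha> \<ge> 1" and "c > 0"
  shows "(\<forall>n\<ge>2. \<bar>min_energy c m \<alpha> n\<bar> \<noteq> \<infinity>) \<and>
         (\<lambda>n. real_of_ereal (min_energy c m \<alpha> n) - real_of_ereal (min_energy c m \<alpha> (n - 1)))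
           \<in> O(\<lambda>n. (ln (real n))\<^sup>2 / (real n)\<^sup>2)"
proof
  have \<alpha>: "0 < \<alpha>" using assms by simp
  note E = min_energy_eq[OF \<alpha> \<open>c > 0\<close>, of _ m]
  show "\<forall>n\<ge>2. \<bar>min_energy c m \<alpha> n\<bar> \<noteq> \<infinity>" using E by simp
  define e where "e = (\<lambda>n. laguerre_energy n \<alpha>)"
  define g where "g = (\<lambda>x::real. x\<^sup>2 * ln x - 3 / 2 * x\<^sup>2)"
  \<comment> \<open>\<open>A\<close> is the error in the classical increment, \<open>B\<close> the
    error in the classical energy itself, and \<open>R\<close> the bounded effect of the exceptional
    weight.\<close>
  define A where "A = (\<lambda>n. e n - e (n - 1) - (2 * real n * ln (real n) - 2 * real n))"
  define B where "B = (\<lambda>n. e n - g (real n))"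
  define R where "R = (\<lambda>n. max_log_energy m \<alpha> n - e n)"
  let ?O = "O(\<lambda>n. (ln (real n))\<^sup>2 / (real n)\<^sup>2)"
  have A: "A \<in> O(\<lambda>n. ln (real n))"
    unfolding A_def e_def by (rule laguerre_energy_asymptotics(1)[OF \<alpha>])
  have B: "(\<lambda>n. B (n - 1)) \<in> O(\<lambda>n. real n * ln (real n))"
  proof -
    have "B \<in> O(\<lambda>n. real n * ln (real n))"
      unfolding B_def e_def g_def by (rule laguerre_energy_asymptotics(2)[OF \<alpha>])
    then have "(\<lambda>n. B (n - 1)) \<in> O(\<lambda>n. real (n - 1) * ln (real (n - 1)))" by (rule bigo_pred)
    also have "(\<lambda>n. real (n - 1) * ln (real (n - 1))) \<in> O(\<lambda>n. real n * ln (real n))"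
    proof (rule bigoI[of _ 1])
      show "\<forall>\<^sub>F n in sequentially. norm (real (n - 1) * ln (real (n - 1))) \<le> 1 * norm (real n * ln (real n))"
        using eventually_ge_at_top[of 2]
        by eventually_elim (auto simp: abs_mult intro!: mult_mono)
    qed
    finally show ?thesis .
  qed
  obtain C where "\<forall>\<^sub>F n in sequentially. \<bar>R n\<bar> \<le> C"
    using max_log_energy_near_laguerre[OF \<alpha>, of m] by (auto simp: R_def e_def)
  then have R: "R \<in> O(\<lambda>_. 1)" by (intro bigoI[of _ C]) simp
  have R': "(\<lambda>n. R (n - 1)) \<in> O(\<lambda>_. 1)" using bigo_pred[OF R] by simp
  \<comment> \<open>The explicit main terms: ln n - ln (n - 1) and the fraction are both 1 / n to
    first order, and these contributions cancel.\<close>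
  have t1: "(\<lambda>n. ln (real n) - ln (real n - 1) - ((real n - 2) * (2 * real n * ln (real n) - 2 * real n) - 2 * g (real n - 1))
      / (real n * (real n - 1) * (real n - 2))) \<in> ?O"
    unfolding g_def by real_asymp
  have t2: "(\<lambda>n. A n * (1 / (real n * (real n - 1)))) \<in> ?O"
    by (rule landau_o.big.trans[OF landau_o.big.mult[OF A landau_o.big_refl]]) real_asymp
  have t3: "(\<lambda>n. B (n - 1) * (2 / (real n * (real n - 1) * (real n - 2)))) \<in> ?O"
    by (rule landau_o.big.trans[OF landau_o.big.mult[OF B landau_o.big_refl]]) real_asymp
  have t4: "(\<lambda>n. R n * (1 / (real n * (real n - 1)))) \<in> ?O"
    by (rule landau_o.big.trans[OF landau_o.big.mult[OF R landau_o.big_refl]]) real_asymp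
  have t5: "(\<lambda>n. R (n - 1) * (1 / ((real n - 1) * (real n - 2)))) \<in> ?O"
    by (rule landau_o.big.trans[OF landau_o.big.mult[OF R' landau_o.big_refl]]) real_asymp
  have "\<forall>\<^sub>F n in sequentially.
      ln (real n) - ln (real n - 1) - ((real n - 2) * (2 * real n * ln (real n) - 2 * real n) - 2 * g (real n - 1))
        / (real n * (real n - 1) * (real n - 2))
      - A n * (1 / (real n * (real n - 1))) + B (n - 1) * (2 / (real n * (real n - 1) * (real n - 2)))
      - R n * (1 / (real n * (real n - 1))) + R (n - 1) * (1 / ((real n - 1) * (real n - 2)))
      = real_of_ereal (min_energy c m \<alpha> n) - real_of_ereal (min_energy c m \<alpha> (n - 1))"
    \<comment> \<open>From 3 on, the formula for the minimal energy also applies to the index n -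
      1.\<close>
    using eventually_ge_at_top[of 3]
  proof eventually_elim
    case (elim n)
    define x where "x = real n"
    define L where "L = 2 * x * ln x - 2 * x"
    have x: "x \<noteq> 0" "x - 1 \<noteq> 0" "x - 2 \<noteq> 0" using elim by (auto simp: x_def)
    have n1: "real (n - 1) = x - 1" using elim by (simp add: x_def)
    have M: "max_log_energy m \<alpha> n = B (n - 1) + g (x - 1) + A n + L + R n"
      "max_log_energy m \<alpha> (n - 1) = B (n - 1) + g (x - 1) + R (n - 1)"
      unfolding A_def B_def R_def L_def n1 x_def[symmetric] by simp_all
    \<comment> \<open>The energy of degree n - 1 occurs with the factor 1 / ((n - 1) (n - 2)) - 1 /
      (n (n - 1)) = 2 / (n (n - 1) (n - 2)). This cubic denominator is why the crude bound O(n ln n)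
      for \<open>B\<close> suffices.\<close>
    have id: "- ((x - 2) * L - 2 * G) / (x * (x - 1) * (x - 2)) - a * (1 / (x * (x - 1))) + b * (2 / (x * (x - 1) * (x - 2)))
        - r * (1 / (x * (x - 1))) + s * (1 / ((x - 1) * (x - 2)))
        = - ((b + G + a + L + r) / (x * (x - 1))) + (b + G + s) / ((x - 1) * (x - 2))" for a b r s G
    proof -
      define y where "y = x - 1"
      define z where "z = x - 2"
      have yz: "y \<noteq> 0" "z \<noteq> 0" "z = x - 2" using x by (auto simp: y_def z_def)
      show ?thesis unfolding y_def[symmetric] z_def[symmetric] using x(1) yz(1,2)
        by (simp add: divide_simps) (simp add: yz(3) algebra_simps)
    qed
    show ?case
    proof -
      have "real_of_ereal (min_energy c m \<alpha> n) = ln x - ln c - max_log_energy m \<alpha> n / (x * (x - 1))"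
        "real_of_ereal (min_energy c m \<alpha> (n - 1)) = ln (x - 1) - ln c - max_log_energy m \<alpha> (n - 1) / ((x - 1) * (x - 2))"
        using E[of n] E[of "n - 1"] elim unfolding n1 by (simp_all add: x_def)
      then show ?thesis
        unfolding M x_def[symmetric] L_def[symmetric]
        using id[of "g (x - 1)" "A n" "B (n - 1)" "R n" "R (n - 1)"] by linarith
    qed
  qed
  moreover have "(\<lambda>n. ln (real n) - ln (real n - 1) - ((real n - 2) * (2 * real n * ln (real n) - 2 * real n) - 2 * g (real n - 1))
        / (real n * (real n - 1) * (real n - 2))
      - A n * (1 / (real n * (real n - 1))) + B (n - 1) * (2 / (real n * (real n - 1) * (real n - 2)))
      - R n * (1 / (real n * (real n - 1))) + R (n - 1) * (1 / ((real n - 1) * (real n - 2)))) \<in> ?O"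
    by (intro sum_in_bigo t1 t2 t3 t4 t5)
  ultimately show "(\<lambda>n. real_of_ereal (min_energy c m \<alpha> n) - real_of_ereal (min_energy c m \<alpha> (n - 1))) \<in> ?O"
    by (rule landau_o.big.in_cong[THEN iffD1])
qed

end
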